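(* Let $B_1\subset\mathbb{R}^2$ be the open unit disk, $N\ge1$, $q>1$, and let $\mathcal{S}\subseteq H^1(B_1,\mathbb{R}^N)\times L^q(B_1,\mathbb{R}^N)$ be a class of pairs satisfying: (Closure) if $(\boldsymbol{u},\boldsymbol{f})\in\mathcal{S}$ and $B_r(x_0)\subset B_1$, then the rescaled pair $(\boldsymbol{u}_{x_0,r},\tilde{\boldsymbol{f}}_{x_0,r})$, with $\boldsymbol{u}_{x_0,r}(y):=\boldsymbol{u}(x_0+ry)$ and $\tilde{\boldsymbol{f}}_{x_0,r}(y):=r^2\boldsymbol{f}(x_0+ry)$ for $y\in B_1$, belongs to $\mathcal{S}$; (Decay) there exist constants $\theta,\gamma\in(0,1)$, $p\ge1$, $\kappa>0$ such that for every $(\boldsymbol{u},\boldsymbol{f})\in\mathcal{S}$, $$\Psi_p(\boldsymbol{u},B_\theta)\le\gamma\,\Psi_p(\boldsymbol{u},B_1)+\kappa\|\boldsymbol{f}\|_{L^q(B_1)}^p .$$ If $(\boldsymbol{u},\boldsymbol{f})\in\mathcal{S}$, then $\boldsymbol{u}$ is locally Hölder continuous in $B_1$; specifically, $\boldsymbol{u}\in C^{0,\eta}_{\mathrm{loc}}(B_1)$ for every Hölder exponent $\eta\in(0,1)$ with $$\eta<\min\Big(\frac{\ln\gamma}{p\ln\theta},\,2-\frac2q\Big).$$ For any compact $K\Subset B_1$, the Hölder seminorm of $\boldsymbol u$ on $K$ depends only on $\eta$, $\theta,\gamma,\kappa$, $p$, the energy $\mathcal{E}(\boldsymbol{u},B_1)$,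 the norm $\|\boldsymbol{f}\|_{L^q(B_1)}$, and $\mathrm{dist}(K,\partial B_1)$ (i.e. it is bounded by a constant depending only on these quantities, for the fixed $q$ and $N$).
   Context: $B_r(x_0)$ is the open ball, $B_r=B_r(0)$. For a ball $B$ and $p\ge1$, the $L^p$-oscillation is $\Psi_p(\boldsymbol v,B):=\inf_{\boldsymbol c\in\mathbb{R}^{N}}\frac1{|B|}\int_B|\boldsymbol v(y)-\boldsymbol c|^p\,\mathrm{d}y$. The Dirichlet energy is $\mathcal{E}(\boldsymbol u,B):=\frac12\int_B|\nabla\boldsymbol u|^2\,\mathrm{d}x$. Continuity refers to a suitable a.e. representative. *)

theory Defs
  imports "HOL-Analysis.Analysis"
begin

section \<open>Lebesgue spaces\<close>

text \<open>
  Elements of function spaces are represented by functions on the whole plane; only their values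
  on the domain \<open>U\<close> matter, and those only up to null sets.
\<close>

definition ae_eq_on :: "'a::euclidean_space set \<Rightarrow> ('a \<Rightarrow> 'b) \<Rightarrow> ('a \<Rightarrow> 'b) \<Rightarrow> bool" where
  "ae_eq_on U u v \<longleftrightarrow> (AE x in lebesgue_on U. u x = v x)"

definition Lp_on :: "real \<Rightarrow> 'a::euclidean_space set \<Rightarrow> ('a \<Rightarrow> 'b::euclidean_space) set" where
  "Lp_on p U = {u. u \<in> borel_measurable (lebesgue_on U) \<and>
                   integrable (lebesgue_on U) (\<lambda>x. norm (u x) powr p)}"

definition Lp_norm_on :: "real \<Rightarrow> 'a::euclidean_space set \<Rightarrow> ('a \<Rightarrow> 'b::euclidean_space) \<Rightarrow> real" where
  "Lp_norm_on p U u = (LINT x|lebesgue_on U. norm (u x) powr p) powr (1 / p)"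

definition locally_integrable_on :: "'a::euclidean_space set \<Rightarrow> ('a \<Rightarrow> 'b::euclidean_space) \<Rightarrow> bool" where
  "locally_integrable_on U u \<longleftrightarrow>
     (\<forall>K. compact K \<and> K \<subseteq> U \<longrightarrow> integrable (lebesgue_on K) u)"


section \<open>Weak gradients, the space \<open>H\<^sup>1\<close> and the Dirichlet energy\<close>

primrec C_k :: "nat \<Rightarrow> ('a::euclidean_space \<Rightarrow> 'b::real_normed_vector) \<Rightarrow> bool" where
  "C_k 0 f \<longleftrightarrow> continuous_on UNIV f"
| "C_k (Suc k) f \<longleftrightarrow> (\<forall>x. f differentiable (at x)) \<and>
                    (\<forall>v. C_k k (\<lambda>x. frechet_derivative f (at x) v))"

definition test_function_on :: "'a::euclidean_space set \<Rightarrow> ('a \<Rightarrow> real) \<Rightarrow> bool" where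
  "test_function_on U \<phi> \<longleftrightarrow>
     (\<forall>k. C_k k \<phi>) \<and> compact (closure {x. \<phi> x \<noteq> 0}) \<and> closure {x. \<phi> x \<noteq> 0} \<subseteq> U"

text \<open>
  The gradient is matrix valued, with \<open>j\<close>-th row the gradient of the \<open>j\<close>-th component of \<open>u\<close>;
  the norm of \<open>real ^ 'd ^ 'n\<close> is the Frobenius norm.
\<close>

definition is_weak_gradient_on ::
    "(real ^ 'd) set \<Rightarrow> (real ^ 'd \<Rightarrow> real ^ 'n) \<Rightarrow> (real ^ 'd \<Rightarrow> real ^ 'd ^ 'n) \<Rightarrow> bool" where
  "is_weak_gradient_on U u G \<longleftrightarrow>
     locally_integrable_on U u \<and> locally_integrable_on U G \<and>
     (\<forall>\<phi> i j. test_function_on U \<phi> \<longrightarrow>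
        (LINT x|lebesgue_on U. u x $ j * frechet_derivative \<phi> (at x) (axis i 1)) =
        - (LINT x|lebesgue_on U. G x $ j $ i * \<phi> x))"

text \<open>On an open set the weak gradient is unique up to a null set; we choose a representative.\<close>

definition weak_gradient :: "(real ^ 'd) set \<Rightarrow> (real ^ 'd \<Rightarrow> real ^ 'n) \<Rightarrow> real ^ 'd \<Rightarrow> real ^ 'd ^ 'n" where
  "weak_gradient U u = (SOME G. is_weak_gradient_on U u G)"

definition H1_on :: "(real ^ 'd) set \<Rightarrow> (real ^ 'd \<Rightarrow> real ^ 'n) set" where
  "H1_on U = {u. u \<in> Lp_on 2 U \<and> (\<exists>G. is_weak_gradient_on U u G) \<and> weak_gradient U u \<in> Lp_on 2 U}"

definition dirichlet_energy :: "(real ^ 'd \<Rightarrow> real ^ 'n) \<Rightarrow> (real ^ 'd) set \<Rightarrow> real" where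
  "dirichlet_energy u U = 1/2 * (LINT x|lebesgue_on U. (norm (weak_gradient U u x))\<^sup>2)"


section \<open>Oscillation and Hoelder seminorm\<close>

text \<open>
  Both quantities take values in \<open>[0,\<infinity>]\<close>, so that no integrability or finiteness has to be
  presupposed.
\<close>

definition osc :: "real \<Rightarrow> ('a::euclidean_space \<Rightarrow> 'b::euclidean_space) \<Rightarrow> 'a set \<Rightarrow> ennreal" where
  "osc p v B = (INF c. (\<integral>\<^sup>+ y. ennreal (norm (v y - c) powr p) \<partial>lebesgue_on B) / emeasure lebesgue B)"

definition holder_seminorm :: "real \<Rightarrow> 'a::metric_space set \<Rightarrow> ('a \<Rightarrow> 'b::metric_space) \<Rightarrow> ennreal" where
  "holder_seminorm \<eta> K v =
     (SUP (x, y) \<in> {(x, y). x \<in> K \<and> y \<in> K \<and> x \<noteq> y}. ennreal (dist (v x) (v y) / dist x y powr \<eta>))"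

definition locally_holder_on :: "real \<Rightarrow> 'a::metric_space set \<Rightarrow> ('a \<Rightarrow> 'b::metric_space) \<Rightarrow> bool" where
  "locally_holder_on \<eta> U v \<longleftrightarrow> (\<forall>K. compact K \<and> K \<subseteq> U \<longrightarrow> holder_seminorm \<eta> K v < \<infinity>)"


section \<open>The closure and decay conditions\<close>

abbreviation unit_disk :: "(real ^ 2) set" where
  "unit_disk \<equiv> ball 0 1"

text \<open>
  A rescaled pair is prescribed on the unit disk only, and up to null sets; hence the class has to
  contain some representative of it.
\<close>

definition rescaling_closed :: "((real ^ 2 \<Rightarrow> real ^ 'n) \<times> (real ^ 2 \<Rightarrow> real ^ 'n)) set \<Rightarrow> bool" where
  "rescaling_closed S \<longleftrightarrow>
     (\<forall>(u, f) \<in> S. \<forall>x\<^sub>0 r. r > 0 \<and> ball x\<^sub>0 r \<subseteq> unit_disk \<longrightarrow>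
        (\<exists>(v, g) \<in> S. ae_eq_on unit_disk v (\<lambda>y. u (x\<^sub>0 + r *\<^sub>R y)) \<and>
                      ae_eq_on unit_disk g (\<lambda>y. r\<^sup>2 *\<^sub>R f (x\<^sub>0 + r *\<^sub>R y))))"

definition osc_decay ::
    "real \<Rightarrow> real \<Rightarrow> real \<Rightarrow> real \<Rightarrow> real \<Rightarrow> ((real ^ 2 \<Rightarrow> real ^ 'n) \<times> (real ^ 2 \<Rightarrow> real ^ 'n)) set \<Rightarrow> bool" where
  "osc_decay q \<theta> \<gamma> \<kappa> p S \<longleftrightarrow>
     (\<forall>(u, f) \<in> S. osc p u (ball 0 \<theta>) \<le>
        ennreal \<gamma> * osc p u unit_disk + ennreal (\<kappa> * Lp_norm_on q unit_disk f powr p))"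

end

theory Submission
  imports Defs
begin

text \<open>
  The decay condition, rescaled to the disks of radius \<open>\<theta>\<^sup>k R\<close> around a point and iterated, shows that
  the oscillation of \<open>u\<close> decays like \<open>(\<theta>\<^sup>k)\<close> to the power \<open>\<eta> p\<close>, and a Campanato argument turns this into
  Hoelder continuity. The only analytic input is a bound of the initial oscillation by the energy, that
  is, the embedding of \<open>H\<^sup>1\<close> into \<open>L\<^sup>p\<close> in the plane. It is obtained without mollification or a
  Poincare inequality: for a product bump function \<open>K\<close>, the difference of two rescaled
  translates of \<open>K\<close> is the divergence of an explicit test vector field, so the very definition of the weak
  gradient bounds the difference of the corresponding averages of \<open>u\<close> by the integral of the gradient
  over a box. Comparing averages at dyadic scales and passing to the limit at Lebesgue points
  controls \<open>u\<close> in \<open>L\<^sup>p\<close>. The same averages define the Hoelder continuous representative.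
\<close>

section \<open>A smooth bump function and its primitive\<close>

text \<open>The final constant is chosen before the class \<open>S\<close>, so every estimate has to
  name its constant; hence the definitions ending in \<open>_const\<close>. The obstacle is that
  \<open>p\<close> is arbitrary while the energy controls only a square, and that in the plane
  finite energy gives no pointwise bound on \<open>u\<close>. The way out is scale invariance:
  halving the scale changes an average by at most a multiple of the square root of the energy in the
  cube, with no power of the radius in front. Hence at a given point it suffices that the energies
  of the shrinking cubes decay geometrically, and a bound on the \<open>p\<close>-th moment of the
  rate of this decay is all that an \<open>L^p\<close> estimate asks for. The kernel is a product
  because two products can be exchanged one coordinate at a time: each one-dimensional difference
  has mean zero, and therefore a primitive of compact support.\<close>

lemma C_k_const: "C_k k (\<lambda>x. c)"
  by (induction k arbitrary: c) (simp_all add: frechet_derivative_const)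

lemma C_k_Suc_imp: "C_k (Suc k) f \<Longrightarrow> C_k k f"
proof (induction k arbitrary: f)
  case 0
  then show ?case
    by (auto simp: continuous_on_eq_continuous_at intro: differentiable_imp_continuous_within)
qed auto

lemma C_k_add:
  assumes "C_k k f" "C_k k g"
  shows "C_k k (\<lambda>x. f x + g x)"
  using assms
proof (induction k arbitrary: f g)
  case 0
  then show ?case by (auto intro: continuous_intros)
next
  case (Suc k)
  have "frechet_derivative (\<lambda>x. f x + g x) (at x) v
      = frechet_derivative f (at x) v + frechet_derivative g (at x) v" for x v
  proof -
    have "((\<lambda>x. f x + g x) has_derivative
        (\<lambda>v. frechet_derivative f (at x) v + frechet_derivative g (at x) v)) (at x)"
      using Suc.prems by (intro has_derivative_add) (auto simp flip: frechet_derivative_works)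
    from fun_cong[OF frechet_derivative_at[OF this], of v] show ?thesis by simp
  qed
  with Suc show ?case by simp
qed

lemma C_k_mult:
  fixes f g :: "'a::euclidean_space \<Rightarrow> real"
  assumes "C_k k f" "C_k k g"
  shows "C_k k (\<lambda>x. f x * g x)"
  using assms
proof (induction k arbitrary: f g)
  case 0
  then show ?case by (auto intro: continuous_intros)
next
  case (Suc k)
  have "frechet_derivative (\<lambda>x. f x * g x) (at x) v
      = f x * frechet_derivative g (at x) v + frechet_derivative f (at x) v * g x" for x v
  proof -
    have "((\<lambda>x. f x * g x) has_derivative
        (\<lambda>v. f x * frechet_derivative g (at x) v + frechet_derivative f (at x) v * g x)) (at x)"
      using Suc.prems by (intro has_derivative_mult) (auto simp flip: frechet_derivative_works)
    from fun_cong[OF frechet_derivative_at[OF this], of v] show ?thesis by simp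
  qed
  moreover have "C_k k f" "C_k k g" using Suc.prems C_k_Suc_imp by blast+
  ultimately show ?case using Suc by (simp add: C_k_add)
qed

lemma C_k_affine:
  fixes f :: "'b::euclidean_space \<Rightarrow> real" and L :: "'a::euclidean_space \<Rightarrow> 'b"
  assumes "C_k k f" "bounded_linear L"
  shows "C_k k (\<lambda>x. f (c + L x))"
  using assms(1)
proof (induction k arbitrary: f)
  case 0
  have "continuous_on UNIV (\<lambda>x. c + L x)"
    by (intro continuous_intros linear_continuous_on assms)
  then show ?case using 0 by (auto intro: continuous_on_compose2)
next
  case (Suc k)
  have der: "((\<lambda>x. f (c + L x)) has_derivative (\<lambda>v. frechet_derivative f (at (c + L x)) (L v))) (at x)" for x
  proof -
    have "(f has_derivative frechet_derivative f (at (c + L x))) (at (c + L x))"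
      using Suc.prems by (simp add: frechet_derivative_works)
    moreover have "((\<lambda>x. c + L x) has_derivative L) (at x)"
      using assms(2) by (auto intro!: derivative_eq_intros bounded_linear_imp_has_derivative)
    ultimately show ?thesis
      using has_derivative_compose[of "\<lambda>x. c + L x" L x UNIV f] by simp
  qed
  then have eq: "frechet_derivative (\<lambda>x. f (c + L x)) (at x) v = frechet_derivative f (at (c + L x)) (L v)" for x v
    by (metis frechet_derivative_at)
  show ?case using der Suc by (auto simp: eq differentiable_def)
qed

lemma C_k_SucI_real:
  fixes f f' :: "real \<Rightarrow> real"
  assumes "\<And>x. (f has_real_derivative f' x) (at x)" "C_k k f'"
  shows "C_k (Suc k) f"
proof -
  have "frechet_derivative f (at x) v = f' x * v" for x v
    using assms(1)[of x] frechet_derivative_at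
    unfolding has_field_derivative_def by metis
  moreover have "f differentiable at x" for x
    using assms(1)[of x] by (auto simp: has_field_derivative_def differentiable_def)
  ultimately show ?thesis using assms(2) by (simp add: C_k_mult C_k_const)
qed

text \<open>Functions of this shape are closed under differentiation, so the smoothness of exp(-1/t)
  extended by 0 follows from one induction over all polynomials at once.\<close>

definition exp_recip :: "real poly \<Rightarrow> real \<Rightarrow> real" where
  "exp_recip P t = (if t > 0 then poly P (1 / t) * exp (- (1 / t)) else 0)"

lemma exp_recip_tendsto_0: "((\<lambda>t. poly P (1 / t) * exp (- (1 / t))) \<longlongrightarrow> (0::real)) (at_right 0)"
proof -
  have "((\<lambda>s. poly P s / exp s) \<longlongrightarrow> 0) (at_top :: real filter)"
  proof -
    have "((\<lambda>s. \<Sum>i\<le>degree P. coeff P i * (s ^ i / exp s)) \<longlongrightarrow> (\<Sum>i\<le>degree P. coeff P i * 0)) at_top"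
      by (intro tendsto_intros tendsto_power_div_exp_0)
    then show ?thesis by (simp add: poly_altdef sum_divide_distrib)
  qed
  then have "((\<lambda>t. poly P (inverse t) / exp (inverse t)) \<longlongrightarrow> 0) (at_right (0::real))"
    using filterlim_inverse_at_top_right filterlim_compose by blast
  then show ?thesis by (simp add: exp_minus field_simps)
qed

lemma exp_recip_has_derivative:
  "(exp_recip P has_real_derivative exp_recip ([:0, 0, 1:] * (P - pderiv P)) t) (at t)"
proof -
  consider "t > 0" | "t < 0" | "t = 0" by linarith
  then show ?thesis
  proof cases
    case 1
    have "((\<lambda>t. poly P (1 / t) * exp (- (1 / t))) has_real_derivative
        exp_recip ([:0, 0, 1:] * (P - pderiv P)) t) (at t)"
      using 1 by (auto intro!: derivative_eq_intros DERIV_chain2[OF poly_DERIV]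
          simp: exp_recip_def field_simps power2_eq_square)
    moreover have "\<forall>\<^sub>F s in nhds t. exp_recip P s = poly P (1 / s) * exp (- (1 / s))"
      using 1 by (auto simp: exp_recip_def eventually_nhds intro!: exI[of _ "{0<..}"])
    ultimately show ?thesis by (subst DERIV_cong_ev[OF refl _ refl]) auto
  next
    case 2
    have "((\<lambda>t. 0) has_real_derivative exp_recip ([:0, 0, 1:] * (P - pderiv P)) t) (at t)"
      using 2 by (simp add: exp_recip_def)
    moreover have "\<forall>\<^sub>F s in nhds t. exp_recip P s = 0"
      using 2 by (auto simp: exp_recip_def eventually_nhds intro!: exI[of _ "{..<0}"])
    ultimately show ?thesis by (subst DERIV_cong_ev[OF refl _ refl]) auto
  next
    case 3
    \<comment> \<open>Dividing by h multiplies the polynomial in 1/h by its variable, so the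
      difference quotient is again of the form treated by
      \<open>exp_recip_tendsto_0\<close>.\<close>
    have "((\<lambda>h. exp_recip P h / h) \<longlongrightarrow> 0) (at_right 0)"
      using exp_recip_tendsto_0[of "pCons 0 P"]
      by (rule Lim_transform_eventually) (auto simp: exp_recip_def eventually_at_filter)
    moreover have "((\<lambda>h. exp_recip P h / h) \<longlongrightarrow> 0) (at_left 0)"
      by (rule tendsto_eventually) (auto simp: exp_recip_def eventually_at_filter)
    ultimately have "((\<lambda>h. exp_recip P h / h) \<longlongrightarrow> 0) (at 0)"
      by (rule filterlim_split_at_real[rotated])
    then show ?thesis using 3 by (simp add: DERIV_def exp_recip_def)
  qed
qed

lemma C_k_exp_recip: "C_k k (exp_recip P)"
proof (induction k arbitrary: P)
  case 0
  have "isCont (exp_recip P) x" for x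
    using exp_recip_has_derivative DERIV_isCont by blast
  then show ?case by (simp add: continuous_on_eq_continuous_at)
next
  case (Suc k)
  show ?case by (rule C_k_SucI_real[OF exp_recip_has_derivative Suc.IH])
qed

definition bump :: "real \<Rightarrow> real" where
  "bump t = exp_recip 1 t * exp_recip 1 (1 - t)"

text \<open>Integration starts at -1 rather than 0, so that 0 is an interior point of the interval
  and the fundamental theorem gives the derivative there too.\<close>

definition bump_prim :: "real \<Rightarrow> real" where
  "bump_prim t = integral {-1..max t (-1)} bump"

lemma C_k_bump: "C_k k bump"
proof -
  have "C_k k (\<lambda>t. exp_recip 1 (1 + (- t)))"
    using C_k_affine[OF C_k_exp_recip, of "\<lambda>t. - t"] bounded_linear_minus[OF bounded_linear_ident] by blast
  then show ?thesis
    unfolding bump_def using C_k_mult C_k_exp_recip by fastforce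
qed

lemma continuous_bump: "continuous_on A bump"
  using C_k_bump[of 0] continuous_on_subset by auto

lemma bump_nonneg: "0 \<le> bump t"
  by (simp add: bump_def exp_recip_def)

lemma bump_le_1: "bump t \<le> 1"
  by (auto simp: bump_def exp_recip_def intro!: mult_le_one)

lemma bump_pos: "0 < t \<Longrightarrow> t < 1 \<Longrightarrow> 0 < bump t"
  by (simp add: bump_def exp_recip_def)

lemma bump_eq_0: "t \<le> 0 \<or> 1 \<le> t \<Longrightarrow> bump t = 0"
  by (auto simp: bump_def exp_recip_def)

lemma bump_prim_eq_0: "t \<le> 0 \<Longrightarrow> bump_prim t = 0"
  unfolding bump_prim_def by (rule integral_unique, rule has_integral_is_0) (auto intro!: bump_eq_0)

lemma bump_prim_has_derivative: "(bump_prim has_real_derivative bump t) (at t)"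
proof (cases "t < 0")
  case True
  have "((\<lambda>t. 0) has_real_derivative bump t) (at t)"
    using True by (simp add: bump_eq_0)
  moreover have "\<forall>\<^sub>F s in nhds t. bump_prim s = 0"
    using True by (auto simp: bump_prim_eq_0 eventually_nhds intro!: exI[of _ "{..<0}"])
  ultimately show ?thesis by (subst DERIV_cong_ev[OF refl _ refl]) auto
next
  case False
  have "((\<lambda>s. integral {-1..s} bump) has_real_derivative bump t) (at t within {-1..t+1})"
    using False by (intro integral_has_real_derivative continuous_bump) auto
  then have "((\<lambda>s. integral {-1..s} bump) has_real_derivative bump t) (at t)"
    using False by (subst (asm) at_within_interior) auto
  moreover have "\<forall>\<^sub>F s in nhds t. bump_prim s = integral {-1..s} bump"
    using False by (auto simp: bump_prim_def eventually_nhds intro!: exI[of _ "{-1<..}"])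
  ultimately show ?thesis by (subst DERIV_cong_ev[OF refl _ refl]) auto
qed

lemma C_k_bump_prim: "C_k k bump_prim"
  by (rule C_k_Suc_imp, rule C_k_SucI_real[OF bump_prim_has_derivative C_k_bump])

lemma bump_prim_mono: "mono bump_prim"
  by (rule monoI, rule DERIV_nonneg_imp_nondecreasing)
    (use bump_prim_has_derivative bump_nonneg in blast)+

lemma bump_prim_eq_const: "1 \<le> t \<Longrightarrow> bump_prim t = bump_prim 1"
proof -
  assume "1 \<le> t"
  have "\<exists>z>1. z < t \<and> bump_prim t - bump_prim 1 = (t - 1) * bump z" if "1 < t"
    by (rule MVT2[OF that bump_prim_has_derivative])
  then show ?thesis using \<open>1 \<le> t\<close> by (cases "t = 1") (auto simp: bump_eq_0)
qed

lemma bump_prim_bounds: "0 \<le> bump_prim t" "bump_prim t \<le> 1"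
proof -
  have "bump_prim t \<le> bump_prim 1" for t
    using monoD[OF bump_prim_mono] bump_prim_eq_const by (metis linear order_refl)
  moreover have "\<exists>z>0. z < 1 \<and> bump_prim 1 - bump_prim 0 = (1 - 0) * bump z"
    by (rule MVT2[OF _ bump_prim_has_derivative]) auto
  ultimately show "bump_prim t \<le> 1"
    using bump_le_1 bump_prim_eq_0[of 0] by (metis diff_zero mult_1 order.trans order_refl)
  show "0 \<le> bump_prim t"
    using monoD[OF bump_prim_mono, of "min t 0" t] bump_prim_eq_0[of "min t 0"] by simp
qed

section \<open>Kernel averages and weak gradients\<close>

lemma integrable_scaleR_supported:
  fixes f :: "'a::euclidean_space \<Rightarrow> 'b::euclidean_space"
  assumes f: "integrable (lebesgue_on Q) f" and Q: "Q \<in> sets lebesgue"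
    and w: "w \<in> borel_measurable borel" "\<And>y. \<bar>w y\<bar> \<le> C" "\<And>y. y \<notin> Q \<Longrightarrow> w y = 0"
  shows "integrable lebesgue (\<lambda>y. w y *\<^sub>R f y)"
proof -
  have wl: "w \<in> borel_measurable (lebesgue_on Q)"
    using w(1) by (simp add: measurable_completion measurable_restrict_space1)
  have "integrable (lebesgue_on Q) (\<lambda>y. w y *\<^sub>R f y)"
  proof (rule Bochner_Integration.integrable_bound[OF integrable_scaleR_right[OF f, of C]])
    show "(\<lambda>y. w y *\<^sub>R f y) \<in> borel_measurable (lebesgue_on Q)"
      using wl f by measurable
    show "AE x in lebesgue_on Q. norm (w x *\<^sub>R f x) \<le> norm (C *\<^sub>R f x)"
    proof (rule AE_I2)
      fix x
      have "\<bar>w x\<bar> \<le> \<bar>C\<bar>" using w(2)[of x] by linarith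
      then show "norm (w x *\<^sub>R f x) \<le> norm (C *\<^sub>R f x)" by (simp add: mult_right_mono)
    qed
  qed
  then have "integrable lebesgue (\<lambda>y. indicator Q y *\<^sub>R (w y *\<^sub>R f y))"
    using Q by (subst (asm) integrable_restrict_space) auto
  moreover have "(\<lambda>y. indicator Q y *\<^sub>R (w y *\<^sub>R f y)) = (\<lambda>y. w y *\<^sub>R f y)"
    using w(3) by (fastforce simp: indicator_def)
  ultimately show ?thesis by simp
qed

lemma integral_supported:
  fixes f :: "'a::euclidean_space \<Rightarrow> 'b::euclidean_space"
  assumes "U \<in> sets lebesgue" "\<And>y. y \<notin> U \<Longrightarrow> f y = 0"
  shows "(LINT y|lebesgue_on U. f y) = (LINT y|lebesgue. f y)"
proof -
  have "(LINT y|lebesgue_on U. f y) = (LINT y|lebesgue. indicator U y *\<^sub>R f y)"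
    using assms(1) by (subst integral_restrict_space) auto
  also have "(\<lambda>y. indicator U y *\<^sub>R f y) = f" using assms(2) by (auto simp: indicator_def)
  finally show ?thesis by simp
qed

section \<open>Product kernels and primitives of their differences\<close>

definition slab :: "2 \<Rightarrow> real ^ 2 \<Rightarrow> real \<Rightarrow> real ^ 2 \<Rightarrow> real" where
  "slab i a r y = bump ((y $ i - a $ i) / r) / r"

definition slab_prim :: "2 \<Rightarrow> real ^ 2 \<Rightarrow> real \<Rightarrow> real ^ 2 \<Rightarrow> real" where
  "slab_prim i a r y = bump_prim ((y $ i - a $ i) / r)"

definition kern :: "real ^ 2 \<Rightarrow> real \<Rightarrow> real ^ 2 \<Rightarrow> real" where
  "kern a r y = slab 1 a r y * slab 2 a r y"

definition cube :: "real ^ 2 \<Rightarrow> real \<Rightarrow> (real ^ 2) set" where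
  "cube a r = cbox a (a + r *\<^sub>R One)"

lemma One_nth [simp]: "(\<Sum>b\<in>(Basis :: (real ^ 'n) set). b $ i) = 1"
proof -
  have "(\<Sum>b\<in>(Basis :: (real ^ 'n) set). b $ i) = One \<bullet> (axis i 1 :: real ^ 'n)"
    by (simp add: inner_sum_left inner_axis del: inner_sum_left_Basis)
  also have "\<dots> = 1" using inner_sum_left_Basis[of "axis i 1 :: real ^ 'n" "\<lambda>_. 1"] by simp
  finally show ?thesis .
qed

lemma mem_cube: "y \<in> cube a r \<longleftrightarrow> (\<forall>i. a $ i \<le> y $ i \<and> y $ i \<le> a $ i + r)"
  by (simp add: cube_def mem_box_cart)

lemma C_k_nth_affine:
  fixes f :: "real \<Rightarrow> real"
  assumes "\<And>k. C_k k f"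
  shows "C_k k (\<lambda>y :: real ^ 2. f ((y $ i - c) / r))"
proof -
  have "bounded_linear (\<lambda>y :: real ^ 2. y $ i / r)"
    by (intro bounded_linear_divide[THEN bounded_linear_compose] bounded_linear_vec_nth)
  from C_k_affine[OF assms this, of k "- (c / r)"] show ?thesis
    by (simp add: diff_divide_distrib)
qed

lemma C_k_slab: "C_k k (slab i a r)"
proof -
  have "C_k k (\<lambda>y. bump ((y $ i - a $ i) / r) * (1 / r))"
    by (intro C_k_mult C_k_const C_k_nth_affine C_k_bump)
  then show ?thesis by (simp add: slab_def[abs_def])
qed

lemma C_k_slab_prim: "C_k k (slab_prim i a r)"
  unfolding slab_prim_def[abs_def] by (intro C_k_nth_affine C_k_bump_prim)

lemma continuous_slab: "continuous_on A (slab i a r)"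
  using C_k_slab[of 0] by (auto intro: continuous_on_subset)

lemma slab_nonneg: "0 < r \<Longrightarrow> 0 \<le> slab i a r y"
  by (simp add: slab_def bump_nonneg)

lemma slab_le: "0 < r \<Longrightarrow> slab i a r y \<le> 1 / r"
  by (simp add: slab_def bump_le_1 divide_right_mono)

lemma slab_eq_0: "0 < r \<Longrightarrow> y $ i < a $ i \<or> a $ i + r < y $ i \<Longrightarrow> slab i a r y = 0"
  by (auto simp: slab_def field_simps intro!: bump_eq_0)

lemma slab_prim_bounds: "0 \<le> slab_prim i a r y" "slab_prim i a r y \<le> 1"
  by (simp_all add: slab_prim_def bump_prim_bounds)

lemma kern_eq_0:
  assumes "0 < r" "y \<notin> cube a r"
  shows "kern a r y = 0"
proof -
  obtain i where "y $ i < a $ i \<or> a $ i + r < y $ i" using assms by (auto simp: mem_cube not_le)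
  then have "slab i a r y = 0" using slab_eq_0 assms by blast
  then show ?thesis using exhaust_2[of i] by (auto simp: kern_def)
qed

lemma kern_nonneg: "0 < r \<Longrightarrow> 0 \<le> kern a r y"
  by (simp add: kern_def slab_nonneg)

lemma kern_le:
  assumes "0 < r"
  shows "kern a r y \<le> 1 / r\<^sup>2"
proof -
  have "slab 1 a r y * slab 2 a r y \<le> 1 / r * (1 / r)"
    using assms by (intro mult_mono slab_le slab_nonneg) auto
  then show ?thesis by (simp add: kern_def power2_eq_square)
qed

lemma continuous_kern: "continuous_on A (kern a r)"
  unfolding kern_def[abs_def] by (intro continuous_intros continuous_slab)

text \<open>The difference of two kernels is the divergence of a vector field with components of this shape.
  They have compact support because \<open>slab_prim\<close> is constant on either side of its slab.\<close>

definition potential :: "2 \<Rightarrow> 2 \<Rightarrow> real ^ 2 \<Rightarrow> real \<Rightarrow> real ^ 2 \<Rightarrow> real \<Rightarrow> real ^ 2 \<Rightarrow> real \<Rightarrow> real ^ 2 \<Rightarrow> real" where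
  "potential i j a r a' r' b s y = (slab_prim i a r y - slab_prim i a' r' y) * slab j b s y"

lemma C_k_potential: "C_k k (potential i j a r a' r' b s)"
proof -
  have "C_k k (\<lambda>y. (slab_prim i a r y + (-1) * slab_prim i a' r' y) * slab j b s y)"
    by (intro C_k_mult C_k_add C_k_const C_k_slab C_k_slab_prim)
  then show ?thesis by (simp add: potential_def[abs_def])
qed

lemma potential_bound:
  assumes "0 < s" shows "\<bar>potential i j a r a' r' b s y\<bar> \<le> 1 / s"
proof -
  have "\<bar>slab_prim i a r y - slab_prim i a' r' y\<bar> \<le> 1"
    using slab_prim_bounds[of i a r y] slab_prim_bounds[of i a' r' y] by linarith
  then show ?thesis
    using mult_mono[OF _ slab_le[OF assms, of j b y], of _ 1] slab_nonneg[OF assms, of j b y]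
    by (simp add: potential_def abs_mult)
qed

text \<open>Beyond the box in direction \<open>j\<close> the factor \<open>slab j\<close> vanishes;
  below it in direction \<open>i\<close> both primitives are 0, above it both equal
  \<open>bump_prim 1\<close>, so they cancel in the difference. The slabs are tracked along with the
  primitives so that the potential and its derivative are covered alike.\<close>

lemma slab_outside_box:
  assumes "0 < r" "0 < r'" "0 < s" "i \<noteq> j" "y \<notin> cbox l h"
    and "cube a r \<subseteq> cbox l h" "cube a' r' \<subseteq> cbox l h" "cube b s \<subseteq> cbox l h"
  shows "slab j b s y = 0 \<or> slab i a r y = 0 \<and> slab i a' r' y = 0 \<and> slab_prim i a r y = slab_prim i a' r' y"
proof -
  have box: "l $ k \<le> c $ k \<and> c $ k + t \<le> h $ k" if "cube c t \<subseteq> cbox l h" "0 < t" for c t k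
  proof -
    have "c \<in> cube c t" "c + t *\<^sub>R One \<in> cube c t" using that by (auto simp: mem_cube)
    then have "c \<in> cbox l h" "c + t *\<^sub>R One \<in> cbox l h" using that(1) by auto
    then show ?thesis by (simp add: mem_box_cart)
  qed
  have ij: "k = i \<or> k = j" for k :: 2
    using exhaust_2[of k] exhaust_2[of i] exhaust_2[of j] \<open>i \<noteq> j\<close> by auto
  obtain k where "y $ k < l $ k \<or> h $ k < y $ k"
    using assms(5) by (auto simp: mem_box_cart not_le)
  then consider "y $ j < l $ j \<or> h $ j < y $ j" | "y $ i < l $ i" | "h $ i < y $ i"
    using ij[of k] by auto
  then show ?thesis
  proof cases
    case 1
    then have "slab j b s y = 0" using box[OF assms(8,3), of j] assms by (intro slab_eq_0) auto
    then show ?thesis ..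
  next
    case 2
    then have "slab_prim i a r y = 0" "slab_prim i a' r' y = 0" "slab i a r y = 0" "slab i a' r' y = 0"
      using box[OF assms(6,1), of i] box[OF assms(7,2), of i] assms
      by (auto simp: slab_prim_def field_simps intro!: bump_prim_eq_0 slab_eq_0)
    then show ?thesis by simp
  next
    case 3
    then have "slab_prim i a r y = bump_prim 1" "slab_prim i a' r' y = bump_prim 1"
        "slab i a r y = 0" "slab i a' r' y = 0"
      using box[OF assms(6,1), of i] box[OF assms(7,2), of i] assms
      by (auto simp: slab_prim_def field_simps intro!: bump_prim_eq_const slab_eq_0)
    then show ?thesis by simp
  qed
qed

lemma potential_eq_0:
  assumes "0 < r" "0 < r'" "0 < s" "i \<noteq> j" "y \<notin> cbox l h"
    and "cube a r \<subseteq> cbox l h" "cube a' r' \<subseteq> cbox l h" "cube b s \<subseteq> cbox l h"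
  shows "potential i j a r a' r' b s y = 0"
  using slab_outside_box[OF assms] by (auto simp: potential_def)

lemma test_function_potential:
  assumes "0 < r" "0 < r'" "0 < s" "i \<noteq> j" "cbox l h \<subseteq> U"
    and "cube a r \<subseteq> cbox l h" "cube a' r' \<subseteq> cbox l h" "cube b s \<subseteq> cbox l h"
  shows "test_function_on U (potential i j a r a' r' b s)"
proof -
  let ?S = "closure {y. potential i j a r a' r' b s y \<noteq> 0}"
  have "?S \<subseteq> cbox l h"
    by (rule closure_minimal) (use potential_eq_0[OF assms(1-4) _ assms(6-8)] in auto)
  then have "compact ?S" "?S \<subseteq> U"
    using assms(5) compact_Int_closed[of "cbox l h" ?S] by (auto simp: Int_absorb1 inf_commute)
  then show ?thesis by (simp add: test_function_on_def C_k_potential)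
qed

lemma frechet_derivative_potential:
  assumes "i \<noteq> j"
  shows "frechet_derivative (potential i j a r a' r' b s) (at y) (axis i 1)
    = (slab i a r y - slab i a' r' y) * slab j b s y"
proof -
  have lin: "((\<lambda>y :: real ^ 2. (y $ k - c) / t) has_derivative (\<lambda>v. v $ k / t)) (at y)" for k c t
    by (auto intro!: derivative_eq_intros bounded_linear_imp_has_derivative bounded_linear_vec_nth
        simp: divide_inverse)
  have prim: "(slab_prim i c t has_derivative (\<lambda>v. (v $ i / t) * bump ((y $ i - c $ i) / t))) (at y)" for c t
    unfolding slab_prim_def[abs_def]
    using DERIV_compose_FDERIV[OF bump_prim_has_derivative lin] by blast
  \<comment> \<open>The product rule asks for a derivative of \<open>slab j\<close> as well. Its
    value \<open>D\<close> disappears in the end, being multiplied by the \<open>j\<close>-th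
    component of \<open>axis i 1\<close>, which is 0.\<close>
  have "\<exists>D. \<forall>t. (bump has_real_derivative D t) (at t)"
  proof -
    have "bump differentiable (at t)" for t
      using C_k_bump[of "Suc 0"] by simp
    then show ?thesis by (metis real_differentiable_def)
  qed
  then obtain D where D: "\<And>t. (bump has_real_derivative D t) (at t)" by blast
  have sl: "(slab j b s has_derivative (\<lambda>v. (v $ j / s) * D ((y $ j - b $ j) / s) / s)) (at y)"
    unfolding slab_def[abs_def]
    using has_derivative_mult_left[OF DERIV_compose_FDERIV[OF D lin], where y = "1 / s"] by simp
  have "(potential i j a r a' r' b s has_derivative
      (\<lambda>v. (slab_prim i a r y - slab_prim i a' r' y) * ((v $ j / s) * D ((y $ j - b $ j) / s) / s)
        + ((v $ i / r) * bump ((y $ i - a $ i) / r) - (v $ i / r') * bump ((y $ i - a' $ i) / r')) * slab j b s y)) (at y)"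
    unfolding potential_def[abs_def]
    by (intro has_derivative_mult has_derivative_diff prim sl)
  from fun_cong[OF frechet_derivative_at[OF this], of "axis i 1"] show ?thesis
    using assms by (simp add: axis_def slab_def)
qed

text \<open>\<open>w\<close> is the derivative of a potential in direction \<open>i\<close>, so
  testing the weak gradient with that potential moves the derivative onto \<open>u\<close>. The
  factor \<open>1 / s\<close> is the height of the potential.\<close>

lemma weak_gradient_potential:
  fixes u :: "real ^ 2 \<Rightarrow> real ^ 'n"
  assumes wg: "is_weak_gradient_on U u G" and U: "open U" "cbox l h \<subseteq> U"
    and pos: "0 < r" "0 < r'" "0 < s" and ij: "i \<noteq> j"
    and cubes: "cube a r \<subseteq> cbox l h" "cube a' r' \<subseteq> cbox l h" "cube b s \<subseteq> cbox l h"
  defines "w \<equiv> \<lambda>y. (slab i a r y - slab i a' r' y) * slab j b s y"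
  shows "integrable lebesgue (\<lambda>y. w y *\<^sub>R u y)"
    and "\<bar>(LINT y|lebesgue. w y *\<^sub>R u y) $ m\<bar> \<le> (1 / s) * (LINT y|lebesgue_on (cbox l h). norm (G y))"
proof -
  let ?Q = "cbox l h" and ?p = "potential i j a r a' r' b s"
  have Us: "U \<in> sets lebesgue" "?Q \<in> sets lebesgue" using U by auto
  have int: "integrable (lebesgue_on ?Q) u" "integrable (lebesgue_on ?Q) G"
    using wg U by (auto simp: is_weak_gradient_on_def locally_integrable_on_def)
  have w0: "w y = 0" if "y \<notin> ?Q" for y
    using slab_outside_box[OF pos ij that cubes] by (auto simp: w_def)
  have p0: "?p y = 0" if "y \<notin> ?Q" for y
    using potential_eq_0[OF pos ij that cubes] .
  have wc: "continuous_on UNIV w"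
    unfolding w_def by (intro continuous_intros continuous_slab)
  have "\<bar>w y\<bar> \<le> (1 / r + 1 / r') * (1 / s)" for y
    unfolding w_def abs_mult using pos
    using slab_nonneg[of r i a y] slab_nonneg[of r' i a' y] slab_le[of r i a y] slab_le[of r' i a' y]
      slab_nonneg[of s j b y] slab_le[of s j b y]
    by (intro mult_mono) auto
  then show intw: "integrable lebesgue (\<lambda>y. w y *\<^sub>R u y)"
    using w0 wc by (intro integrable_scaleR_supported[OF int(1) Us(2)] borel_measurable_continuous_onI)
  have "(LINT y|lebesgue. w y *\<^sub>R u y) $ m = (LINT y|lebesgue. (w y *\<^sub>R u y) $ m)"
    using integral_bounded_linear[OF bounded_linear_vec_nth intw] by metis
  also have "\<dots> = (LINT y|lebesgue_on U. (w y *\<^sub>R u y) $ m)"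
    using w0 U by (intro integral_supported[symmetric] Us) auto
  also have "\<dots> = (LINT y|lebesgue_on U. u y $ m * frechet_derivative ?p (at y) (axis i 1))"
    by (simp add: frechet_derivative_potential[OF ij] w_def mult.commute)
  also have "\<dots> = - (LINT y|lebesgue_on U. G y $ m $ i * ?p y)"
    using wg test_function_potential[OF pos ij U(2) cubes] by (simp add: is_weak_gradient_on_def)
  also have "(LINT y|lebesgue_on U. G y $ m $ i * ?p y) = (LINT y|lebesgue_on ?Q. G y $ m $ i * ?p y)"
    using p0 U by (subst (1 2) integral_supported) (use Us in auto)
  finally have eq: "(LINT y|lebesgue. w y *\<^sub>R u y) $ m = - (LINT y|lebesgue_on ?Q. G y $ m $ i * ?p y)" .
  have "\<bar>LINT y|lebesgue_on ?Q. G y $ m $ i * ?p y\<bar> \<le> (LINT y|lebesgue_on ?Q. (1 / s) * norm (G y))"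
  proof (rule order.trans[OF integral_abs_bound])
    have "\<bar>G y $ m $ i * ?p y\<bar> \<le> 1 / s * norm (G y)" for y
    proof -
      have "\<bar>G y $ m $ i\<bar> \<le> norm (G y)"
        using component_le_norm_cart[of "G y $ m" i] Finite_Cartesian_Product.norm_nth_le[of "G y" m] by linarith
      then show ?thesis
        using mult_mono[OF potential_bound[OF pos(3)], of "\<bar>G y $ m $ i\<bar>" "norm (G y)"] pos
        by (simp add: abs_mult mult.commute)
    qed
    moreover have "AE y in lebesgue_on ?Q. 0 \<le> 1 / s * norm (G y)" using pos by simp
    ultimately show "(LINT y|lebesgue_on ?Q. \<bar>G y $ m $ i * ?p y\<bar>) \<le> (LINT y|lebesgue_on ?Q. 1 / s * norm (G y))"
      using int(2) by (intro integral_mono_AE') auto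
  qed
  then show "\<bar>(LINT y|lebesgue. w y *\<^sub>R u y) $ m\<bar> \<le> (1 / s) * (LINT y|lebesgue_on ?Q. norm (G y))"
    by (simp add: eq)
qed

text \<open>The two kernels may differ in position and in scale; any box containing both cubes will
  do. \<open>1 / r\<close> and \<open>1 / r'\<close> are the heights of the two potentials, and
  \<open>CARD('n)\<close> comes from summing over the components of \<open>u\<close>.\<close>

lemma weak_gradient_kern_diff:
  fixes u :: "real ^ 2 \<Rightarrow> real ^ 'n"
  assumes wg: "is_weak_gradient_on U u G" and U: "open U" "cbox l h \<subseteq> U"
    and pos: "0 < r" "0 < r'" and cubes: "cube a r \<subseteq> cbox l h" "cube a' r' \<subseteq> cbox l h"
  shows "norm ((LINT y|lebesgue. kern a r y *\<^sub>R u y) - (LINT y|lebesgue. kern a' r' y *\<^sub>R u y))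
    \<le> CARD('n) * ((1 / r + 1 / r') * (LINT y|lebesgue_on (cbox l h). norm (G y)))"
proof -
  have int: "integrable (lebesgue_on (cbox l h)) u"
    using wg U by (auto simp: is_weak_gradient_on_def locally_integrable_on_def)
  have intk: "integrable lebesgue (\<lambda>y. kern c t y *\<^sub>R u y)" if "cube c t \<subseteq> cbox l h" "0 < t" for c t
  proof (rule integrable_scaleR_supported[OF int])
    show "\<bar>kern c t y\<bar> \<le> 1 / t\<^sup>2" for y using kern_le kern_nonneg that by simp
  qed (use kern_eq_0 that in \<open>auto intro!: borel_measurable_continuous_onI continuous_kern\<close>)
  note W1 = weak_gradient_potential[OF wg U pos(1,2,1) _ cubes(1,2,1), of 1 2]
  note W2 = weak_gradient_potential[OF wg U pos(1,2,2) _ cubes(1,2,2), of 2 1]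
  have "(LINT y|lebesgue. kern a r y *\<^sub>R u y) - (LINT y|lebesgue. kern a' r' y *\<^sub>R u y)
      = (LINT y|lebesgue. kern a r y *\<^sub>R u y - kern a' r' y *\<^sub>R u y)"
    using intk cubes pos by (intro Bochner_Integration.integral_diff[symmetric]) auto
  \<comment> \<open>The slab in coordinate 1 is exchanged while \<open>slab 2 a r\<close> stays,
    then the slab in coordinate 2 while \<open>slab 1 a' r'\<close> stays.\<close>
  also have "\<dots> = (LINT y|lebesgue. ((slab 1 a r y - slab 1 a' r' y) * slab 2 a r y) *\<^sub>R u y
      + ((slab 2 a r y - slab 2 a' r' y) * slab 1 a' r' y) *\<^sub>R u y)"
    by (intro Bochner_Integration.integral_cong) (auto simp: kern_def algebra_simps)
  also have "\<dots> = (LINT y|lebesgue. ((slab 1 a r y - slab 1 a' r' y) * slab 2 a r y) *\<^sub>R u y)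
      + (LINT y|lebesgue. ((slab 2 a r y - slab 2 a' r' y) * slab 1 a' r' y) *\<^sub>R u y)"
    using W1(1) W2(1) by (intro Bochner_Integration.integral_add) auto
  finally have eq: "(LINT y|lebesgue. kern a r y *\<^sub>R u y) - (LINT y|lebesgue. kern a' r' y *\<^sub>R u y) = \<dots>" .
  let ?I = "LINT y|lebesgue_on (cbox l h). norm (G y)"
  have comp: "\<bar>((LINT y|lebesgue. kern a r y *\<^sub>R u y) - (LINT y|lebesgue. kern a' r' y *\<^sub>R u y)) $ m\<bar>
      \<le> (1 / r + 1 / r') * ?I" for m
    unfolding eq using W1(2)[of m] W2(2)[of m] by (simp add: algebra_simps)
  show ?thesis
    by (rule order.trans[OF norm_le_l1_cart], rule order.trans[OF sum_mono[OF comp]]) simp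
qed

section \<open>Change of variables, normalised averages and Lebesgue points\<close>

lemma nn_integral_affine_lebesgue:
  fixes f :: "'a::euclidean_space \<Rightarrow> ennreal"
  assumes f: "f \<in> borel_measurable lebesgue" and c: "0 < c"
  shows "(\<integral>\<^sup>+ x. f x \<partial>lebesgue) = ennreal (c ^ DIM('a)) * (\<integral>\<^sup>+ x. f (t + c *\<^sub>R x) \<partial>lebesgue)"
proof -
  have T: "t + (\<Sum>j\<in>Basis. (c * (x \<bullet> j)) *\<^sub>R j) = t + c *\<^sub>R x" for x :: 'a
    by (simp add: euclidean_representation flip: scaleR_scaleR scaleR_sum_right)
  have leb: "lebesgue = density (distr lebesgue lebesgue (\<lambda>x :: 'a. t + c *\<^sub>R x)) (\<lambda>_. ennreal (c ^ DIM('a)))"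
    using lebesgue_affine_euclidean[of "\<lambda>_. c" t] c by (simp add: T)
  have [measurable]: "(\<lambda>x :: 'a. t + c *\<^sub>R x) \<in> lebesgue \<rightarrow>\<^sub>M lebesgue"
    using lebesgue_affine_measurable[of "\<lambda>_. c" t] c by (simp add: T)
  note f[measurable]
  have "(\<integral>\<^sup>+ x. f x \<partial>lebesgue)
      = (\<integral>\<^sup>+ x. f x \<partial>density (distr lebesgue lebesgue (\<lambda>x :: 'a. t + c *\<^sub>R x)) (\<lambda>_. ennreal (c ^ DIM('a))))"
    by (subst leb) simp
  also have "\<dots> = (\<integral>\<^sup>+ x. ennreal (c ^ DIM('a)) * f x \<partial>distr lebesgue lebesgue (\<lambda>x :: 'a. t + c *\<^sub>R x))"
    by (subst nn_integral_density) auto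
  also have "\<dots> = (\<integral>\<^sup>+ x. ennreal (c ^ DIM('a)) * f (t + c *\<^sub>R x) \<partial>lebesgue)"
    by (subst nn_integral_distr) auto
  also have "\<dots> = ennreal (c ^ DIM('a)) * (\<integral>\<^sup>+ x. f (t + c *\<^sub>R x) \<partial>lebesgue)"
    by (subst nn_integral_cmult) (auto intro!: measurable_compose[OF _ f])
  finally show ?thesis .
qed

lemma integrable_lebesgue_on_subset:
  fixes f :: "'a::euclidean_space \<Rightarrow> 'b::{banach, second_countable_topology}"
  assumes "integrable (lebesgue_on S) f" "T \<subseteq> S" "T \<in> sets lebesgue" "S \<in> sets lebesgue"
  shows "integrable (lebesgue_on T) f"
proof -
  have "set_integrable lebesgue S f"
    using assms by (subst (asm) integrable_restrict_space) (auto simp: set_integrable_def)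
  then have "set_integrable lebesgue T f"
    using assms set_integrable_subset by blast
  then show ?thesis
    using assms by (subst integrable_restrict_space) (auto simp: set_integrable_def)
qed

lemma integrable_const_lebesgue_on [simp]:
  fixes c :: "'b::{banach, second_countable_topology}"
  shows "S \<in> lmeasurable \<Longrightarrow> integrable (lebesgue_on S) (\<lambda>x. c)"
  by (intro finite_measure.integrable_const finite_measure_lebesgue_on)

text \<open>The crude factor 2 comes from adding the two coordinates; it determines the safety
  margins below, such as \<open>norm x + 2 * r < 1\<close> and the cube side \<open>R / 4\<close> in
  the Hoelder estimate.\<close>

lemma norm_cube_diff_le:
  assumes "y \<in> cube a r" shows "norm (y - a) \<le> 2 * r"
proof -
  have "norm (y - a) \<le> (\<Sum>i\<in>UNIV. \<bar>(y - a) $ i\<bar>)" by (rule norm_le_l1_cart)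
  also have "\<dots> \<le> (\<Sum>i\<in>(UNIV :: 2 set). r)"
  proof (rule sum_mono)
    fix i show "\<bar>(y - a) $ i\<bar> \<le> r" using assms[unfolded mem_cube, rule_format, of i] by simp
  qed
  finally show ?thesis by simp
qed

text \<open>The bump is not normalised; averages are divided by this mass, which is the same at all
  positions and scales by \<open>integral_kern\<close>.\<close>

definition kmass :: real where
  "kmass = (LINT y|lebesgue. kern 0 1 y)"

definition kavg :: "(real ^ 2 \<Rightarrow> 'b::euclidean_space) \<Rightarrow> real ^ 2 \<Rightarrow> real \<Rightarrow> 'b" where
  "kavg u a r = (1 / kmass) *\<^sub>R (LINT y|lebesgue. kern a r y *\<^sub>R u y)"

lemma cube_lmeasurable [simp]: "cube a r \<in> lmeasurable"
  by (simp add: cube_def)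

lemma borel_measurable_kern [measurable]: "kern a r \<in> borel_measurable borel"
  by (intro borel_measurable_continuous_onI continuous_kern)

lemma integrable_kern_scaleR:
  fixes u :: "real ^ 2 \<Rightarrow> 'b::euclidean_space"
  assumes "0 < r" "cube a r \<subseteq> S" "S \<in> sets lebesgue" "integrable (lebesgue_on S) u"
  shows "integrable lebesgue (\<lambda>y. kern a r y *\<^sub>R u y)"
proof (rule integrable_scaleR_supported[OF assms(4,3)])
  show "\<bar>kern a r y\<bar> \<le> 1 / r\<^sup>2" for y using kern_le kern_nonneg assms by simp
qed (use kern_eq_0 assms in auto)

lemma integrable_kern: "0 < r \<Longrightarrow> integrable lebesgue (kern a r)"
  using integrable_kern_scaleR[of r a "cube a r" "\<lambda>_. 1 :: real"]
  by (simp add: fmeasurableD)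

lemma integral_kern:
  assumes r: "0 < r"
  shows "(LINT y|lebesgue. kern a r y) = kmass"
proof -
  have scale: "kern a r (a + r *\<^sub>R y) = kern 0 1 y / r\<^sup>2" for y
    using r by (simp add: kern_def slab_def power2_eq_square)
  have m: "(\<lambda>y. ennreal (kern c s y)) \<in> borel_measurable lebesgue" for c s
    by (intro measurable_completion) simp
  have "(\<integral>\<^sup>+ y. ennreal (kern a r y) \<partial>lebesgue) = ennreal (r ^ 2) * (\<integral>\<^sup>+ y. ennreal (kern 0 1 y / r\<^sup>2) \<partial>lebesgue)"
    using nn_integral_affine_lebesgue[OF m r, of a r a] by (simp add: scale)
  also have "\<dots> = (\<integral>\<^sup>+ y. ennreal (r ^ 2) * ennreal (kern 0 1 y / r\<^sup>2) \<partial>lebesgue)"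
    using m[of 0 1] by (intro nn_integral_cmult[symmetric] measurable_completion) simp
  also have "\<dots> = (\<integral>\<^sup>+ y. ennreal (kern 0 1 y) \<partial>lebesgue)"
    using r by (intro nn_integral_cong) (simp add: kern_nonneg flip: ennreal_mult)
  finally show ?thesis
    unfolding kmass_def using r by (subst (1 2) integral_eq_nn_integral) (auto simp: kern_nonneg measurable_completion)
qed

text \<open>A nonnegative kernel of mass 0 would vanish almost everywhere, but this one is positive
  on the open unit square.\<close>

lemma kmass_pos: "0 < kmass"
proof -
  have "0 \<le> kmass" unfolding kmass_def by (simp add: kern_nonneg)
  moreover have "kmass \<noteq> 0"
  proof
    assume "kmass = 0"
    then have "AE y in lebesgue. kern 0 1 y = 0"
      unfolding kmass_def using integrable_kern[of 1 0]
      by (subst (asm) integral_nonneg_eq_0_iff_AE) (auto simp: kern_nonneg)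
    then have "AE y in lebesgue. y \<notin> box (0 :: real ^ 2) One"
    proof eventually_elim
      case (elim y)
      have "bump (y $ 1) = 0 \<or> bump (y $ 2) = 0" using elim by (simp add: kern_def slab_def)
      then have "\<not> (0 < y $ 1 \<and> y $ 1 < 1 \<and> 0 < y $ 2 \<and> y $ 2 < 1)"
        using bump_pos[of "y $ 1"] bump_pos[of "y $ 2"] by auto
      then show ?case by (simp add: mem_box_cart forall_2)
    qed
    then have "box (0 :: real ^ 2) One \<in> null_sets lebesgue"
      by (subst (asm) AE_iff_null_sets[symmetric]) auto
    moreover have "box (0 :: real ^ 2) One \<noteq> {}"
      by (auto simp: box_ne_empty)
    ultimately show False
      using open_not_negligible[OF open_box] by (auto simp: negligible_iff_null_sets)
  qed
  ultimately show ?thesis by simp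
qed

text \<open>Averaging reproduces constants, so \<open>c\<close> can be moved inside, where the
  kernel is at most \<open>1 / r\<^sup>2\<close>.\<close>

lemma kavg_diff_const:
  fixes u :: "real ^ 2 \<Rightarrow> 'b::euclidean_space"
  assumes r: "0 < r" and S: "cube a r \<subseteq> S" "S \<in> lmeasurable" and u: "integrable (lebesgue_on S) u"
  shows "norm (kavg u a r - c) \<le> 1 / (kmass * r\<^sup>2) * (LINT y|lebesgue_on S. norm (u y - c))"
proof -
  have Ss: "S \<in> sets lebesgue" using S(2) by auto
  have int: "integrable (lebesgue_on S) (\<lambda>y. u y - c)"
    using u S(2) by (intro Bochner_Integration.integrable_diff) auto
  have "(LINT y|lebesgue. kern a r y *\<^sub>R (u y - c))
      = (LINT y|lebesgue. kern a r y *\<^sub>R u y) - (LINT y|lebesgue. kern a r y *\<^sub>R c)"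
    unfolding scaleR_diff_right using r S Ss u
    by (intro Bochner_Integration.integral_diff integrable_kern_scaleR) auto
  also have "(LINT y|lebesgue. kern a r y *\<^sub>R c) = kmass *\<^sub>R c"
    using integrable_kern[OF r, of a] integral_kern[OF r, of a] by simp
  finally have "kavg u a r - c = (1 / kmass) *\<^sub>R (LINT y|lebesgue. kern a r y *\<^sub>R (u y - c))"
    using kmass_pos by (simp add: kavg_def scaleR_diff_right)
  then have "norm (kavg u a r - c) = 1 / kmass * norm (LINT y|lebesgue. kern a r y *\<^sub>R (u y - c))"
    using kmass_pos by simp
  also have "(LINT y|lebesgue. kern a r y *\<^sub>R (u y - c)) = (LINT y|lebesgue_on S. kern a r y *\<^sub>R (u y - c))"
    using kern_eq_0[OF r] S(1) Ss by (intro integral_supported[symmetric]) auto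
  also have "norm \<dots> \<le> (LINT y|lebesgue_on S. 1 / r\<^sup>2 * norm (u y - c))"
  proof (rule order.trans[OF integral_norm_bound])
    have "norm (kern a r y *\<^sub>R (u y - c)) \<le> 1 / r\<^sup>2 * norm (u y - c)" for y
      unfolding norm_scaleR using kern_le[OF r] kern_nonneg[OF r] by (intro mult_right_mono) auto
    moreover have "integrable (lebesgue_on S) (\<lambda>y. 1 / r\<^sup>2 * norm (u y - c))"
      using int by (intro integrable_mult_right integrable_norm)
    ultimately show "(LINT y|lebesgue_on S. norm (kern a r y *\<^sub>R (u y - c))) \<le> (LINT y|lebesgue_on S. 1 / r\<^sup>2 * norm (u y - c))"
      by (intro integral_mono_AE' AE_I2) simp_all
  qed
  finally show ?thesis using kmass_pos by (simp add: field_simps)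
qed

text \<open>Lebesgue differentiation, applied to \<open>norm (u y - c)\<close> for all \<open>c\<close> in a countable dense set, shows that
  almost every point is a Lebesgue point.\<close>

lemma AE_kavg_tendsto:
  fixes u :: "real ^ 2 \<Rightarrow> 'b::euclidean_space"
  assumes U: "open U" and u: "integrable (lebesgue_on U) u"
  shows "AE x in lebesgue_on U. (kavg u x \<longlongrightarrow> u x) (at_right 0)"
proof -
  have Us: "U \<in> sets lebesgue" using U by auto
  \<comment> \<open>Extension by zero, because the differentiation theorem asks for integrability on
    every box of the plane.\<close>
  define w where "w = (\<lambda>y. indicator U y *\<^sub>R u y)"
  have w: "integrable lebesgue w"
    using u Us by (subst (asm) integrable_restrict_space) (auto simp: w_def)
  obtain D :: "'b set" where D: "countable D" "\<And>X. open X \<Longrightarrow> X \<noteq> {} \<Longrightarrow> \<exists>d\<in>D. d \<in> X"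
    by (rule countable_dense_setE) blast
  have intc: "integrable (lebesgue_on (cbox a b)) (\<lambda>y. norm (w y - c))" for a b c
  proof (intro integrable_norm Bochner_Integration.integrable_diff)
    have "integrable (lebesgue_on UNIV) w" using w by (simp only: lebesgue_on_UNIV_eq)
    then show "integrable (lebesgue_on (cbox a b)) w"
      by (rule integrable_lebesgue_on_subset) auto
  qed simp
  \<comment> \<open>Differentiation along cubes with lower corner \<open>x\<close>: this is why the
    kernel sits on one side of its base point instead of being centred there.\<close>
  have ex: "\<exists>N. negligible N \<and> (\<forall>x e. x \<notin> N \<longrightarrow> 0 < e \<longrightarrow>
      (\<exists>d>0. \<forall>h. 0 < h \<and> h < d \<longrightarrow>
        norm (integral (cube x h) (\<lambda>y. norm (w y - c)) /\<^sub>R h ^ 2 - norm (w x - c)) < e))" for c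
  proof -
    have int: "(\<lambda>y. norm (w y - c)) integrable_on cbox a b" for a b
      by (rule integrable_on_lebesgue_on[OF intc]) simp
    obtain N where N: "negligible N"
        "\<And>x e. x \<notin> N \<Longrightarrow> 0 < e \<Longrightarrow> \<exists>d>0. \<forall>h. 0 < h \<and> h < d \<longrightarrow>
          norm (integral (cbox x (x + h *\<^sub>R One)) (\<lambda>y. norm (w y - c)) /\<^sub>R h ^ DIM(real ^ 2) - norm (w x - c)) < e"
      by (rule integrable_ccontinuous_explicit[OF int]) (rule that, assumption, blast)
    have dim: "DIM(real ^ 2) = 2" by simp
    show ?thesis
      by (rule exI[of _ N]) (use N in \<open>unfold cube_def dim, blast\<close>)
  qed
  then obtain N where N: "\<And>c. negligible (N c)"
      "\<And>c x e. x \<notin> N c \<Longrightarrow> 0 < e \<Longrightarrow> \<exists>d>0. \<forall>h. 0 < h \<and> h < d \<longrightarrow>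
        norm (integral (cube x h) (\<lambda>y. norm (w y - c)) /\<^sub>R h ^ 2 - norm (w x - c)) < e"
    by metis
  have "negligible (\<Union>c\<in>D. N c)"
    using D(1) N(1) by (intro negligible_countable_Union) auto
  moreover have "(kavg u x \<longlongrightarrow> u x) (at_right 0)" if x: "x \<in> U" "x \<notin> (\<Union>c\<in>D. N c)" for x
  proof (rule tendstoI)
    fix e :: real assume e: "0 < e"
    \<comment> \<open>If \<open>u x\<close> is within e' of \<open>c\<close> and the mean of
      \<open>norm (u y - c)\<close> over the cube is below 2 e', then the average is within 2 e' /
      \<open>kmass\<close> of \<open>c\<close>; the two errors are made to add up to
      \<open>e\<close>.\<close>
    define e' where "e' = e / (1 + 2 / kmass)"
    have "0 < 1 + 2 / kmass" using kmass_pos by (simp add: add_pos_pos)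
    then have "0 < e'" "e' * (1 + 2 / kmass) = e" using e by (simp_all add: e'_def)
    then have e': "0 < e'" "e' + 2 * e' / kmass = e" by (simp_all add: algebra_simps)
    obtain c where c: "c \<in> D" "c \<in> ball (u x) e'" using D(2)[of "ball (u x) e'"] e' by auto
    obtain d1 where d1: "0 < d1" "\<And>h. 0 < h \<Longrightarrow> h < d1 \<Longrightarrow>
        norm (integral (cube x h) (\<lambda>y. norm (w y - c)) /\<^sub>R h ^ 2 - norm (w x - c)) < e'"
      using N(2)[of x c e'] x c e' by blast
    obtain d2 where d2: "0 < d2" "ball x d2 \<subseteq> U" using U x openE by blast
    have "dist (kavg u x h) (u x) < e" if h: "0 < h" "h < min d1 (d2 / 2)" for h
    proof -
      have sub: "cube x h \<subseteq> U"
      proof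
        fix y assume y: "y \<in> cube x h"
        have "dist x y \<le> 2 * h"
          using norm_cube_diff_le[OF y] by (simp add: dist_norm norm_minus_commute)
        then have "y \<in> ball x d2" using h by simp
        with d2(2) show "y \<in> U" by blast
      qed
      have wu: "w y = u y" if "y \<in> cube x h" for y using subsetD[OF sub that] by (simp add: w_def)
      have iu: "integrable (lebesgue_on (cube x h)) u"
        by (rule integrable_lebesgue_on_subset[OF u sub _ Us]) (rule fmeasurableD, rule cube_lmeasurable)
      have "integral (cube x h) (\<lambda>y. norm (w y - c)) = (LINT y|lebesgue_on (cube x h). norm (w y - c))"
        unfolding cube_def by (rule lebesgue_integral_eq_integral[OF intc, symmetric]) simp
      also have "\<dots> = (LINT y|lebesgue_on (cube x h). norm (u y - c))"
        by (intro Bochner_Integration.integral_cong) (simp_all add: wu space_restrict_space)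
      finally have I: "integral (cube x h) (\<lambda>y. norm (w y - c)) = (LINT y|lebesgue_on (cube x h). norm (u y - c))" .
      have wx: "w x = u x" using x(1) by (simp add: w_def)
      have "0 < h" "h < d1" using h by auto
      from d1(2)[OF this] have "\<bar>(LINT y|lebesgue_on (cube x h). norm (u y - c)) /\<^sub>R h\<^sup>2 - norm (u x - c)\<bar> < e'"
        unfolding I wx real_norm_def .
      then have "(LINT y|lebesgue_on (cube x h). norm (u y - c)) / h\<^sup>2 < norm (u x - c) + e'"
        by (simp add: divide_inverse mult.commute)
      moreover have nc: "norm (u x - c) < e'" using c(2) by (simp add: dist_norm)
      ultimately have lt: "(LINT y|lebesgue_on (cube x h). norm (u y - c)) / h\<^sup>2 < 2 * e'" by simp
      have "norm (kavg u x h - c) \<le> 1 / kmass * ((LINT y|lebesgue_on (cube x h). norm (u y - c)) / h\<^sup>2)"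
        using kavg_diff_const[OF h(1) subset_refl cube_lmeasurable iu, of c] by simp
      also have "\<dots> \<le> 1 / kmass * (2 * e')"
        using lt kmass_pos by (intro mult_left_mono) auto
      finally have "norm (kavg u x h - c) \<le> 2 * e' / kmass" by simp
      then show ?thesis
        using norm_triangle_ineq4[of "kavg u x h - c" "u x - c"] nc e'(2) by (simp add: dist_norm)
    qed
    then show "\<forall>\<^sub>F h in at_right 0. dist (kavg u x h) (u x) < e"
      using d1(1) d2(1) by (auto simp: eventually_at_right_field intro!: exI[of _ "min d1 (d2 / 2)"])
  qed
  ultimately show ?thesis
    by (intro AE_I'[of "(\<Union>c\<in>D. N c) \<inter> U"])
      (auto simp: null_sets_restrict_space Us negligible_iff_null_sets intro!: null_set_Int2)
qed

section \<open>Integrability to every power from the Dirichlet energy\<close>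

lemma geometric_telescope:
  fixes W :: "nat \<Rightarrow> 'a::real_normed_vector"
  assumes b: "0 \<le> b" "b < 1" and A: "0 \<le> A" and step: "\<And>k. m \<le> k \<Longrightarrow> norm (W (Suc k) - W k) \<le> A * b ^ k"
    and n: "m \<le> n"
  shows "norm (W n - W m) \<le> A * b ^ m / (1 - b)"
proof -
  \<comment> \<open>The difference b^m - b^n is what survives the induction step; b^n is dropped
    only afterwards.\<close>
  have "norm (W n - W m) \<le> A * (b ^ m - b ^ n) / (1 - b)"
    using n
  proof (induction n rule: dec_induct)
    case base
    then show ?case by simp
  next
    case (step n)
    have "norm (W (Suc n) - W m) \<le> norm (W (Suc n) - W n) + norm (W n - W m)"
      using norm_triangle_ineq[of "W (Suc n) - W n" "W n - W m"] by simp
    also have "\<dots> \<le> A * b ^ n + A * (b ^ m - b ^ n) / (1 - b)"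
      using step assms(4) by (intro add_mono) auto
    also have "\<dots> = A * (b ^ m - b ^ Suc n) / (1 - b)"
      using b by (simp add: field_simps)
    finally show ?case .
  qed
  also have "\<dots> \<le> A * b ^ m / (1 - b)"
    using b A by (intro divide_right_mono mult_left_mono) auto
  finally show ?thesis .
qed

lemma geometric_telescope_limit:
  fixes W :: "nat \<Rightarrow> 'a::real_normed_vector"
  assumes "0 \<le> b" "b < 1" "0 \<le> A" "\<And>k. m \<le> k \<Longrightarrow> norm (W (Suc k) - W k) \<le> A * b ^ k" and lim: "W \<longlonglongrightarrow> L"
  shows "norm (L - W m) \<le> A * b ^ m / (1 - b)"
proof (rule Lim_bounded)
  show "(\<lambda>n. norm (W n - W m)) \<longlonglongrightarrow> norm (L - W m)"
    by (intro tendsto_intros lim)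
  show "\<forall>n\<ge>m. norm (W n - W m) \<le> A * b ^ m / (1 - b)"
    using geometric_telescope[OF assms(1-4)] by blast
qed

section \<open>Fubini for integrals over translated cubes\<close>

lemma sigma_finite_lebesgue: "sigma_finite_measure (lebesgue :: 'a::euclidean_space measure)"
proof -
  obtain A :: "'a set set" where "countable A" "A \<subseteq> sets lborel" "\<Union>A = space lborel" "\<forall>a\<in>A. emeasure lborel a \<noteq> \<infinity>"
    using lborel.sigma_finite_countable by blast
  then show ?thesis
    by (intro sigma_finite_measure.intro exI[of _ A]) (auto simp: emeasure_completion)
qed

lemma measure_cube: "0 < r \<Longrightarrow> measure lebesgue (cube a r) = r\<^sup>2"
  by (simp add: cube_def content_cbox_cart power2_eq_square interval_ne_empty_cart
      measure_completion UNIV_2 prod.insert)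

lemma measurable_indicator_cube:
  "(\<lambda>(x, y). indicator (cube x r) y :: ennreal) \<in> borel_measurable (lebesgue \<Otimes>\<^sub>M lebesgue)"
proof -
  have [measurable]: "(\<lambda>x :: real ^ 2. x $ i) \<in> borel_measurable lebesgue" for i
    by (intro measurable_completion) simp
  have "(\<lambda>(x, y). indicator (cube x r) y :: ennreal)
      = (\<lambda>p. if (fst p $ 1 \<le> snd p $ 1 \<and> snd p $ 1 \<le> fst p $ 1 + r)
             \<and> (fst p $ 2 \<le> snd p $ 2 \<and> snd p $ 2 \<le> fst p $ 2 + r) then 1 else 0)"
    by (auto simp: indicator_def mem_cube forall_2 fun_eq_iff)
  then show ?thesis by simp
qed

text \<open>The corners \<open>x\<close> of the cubes containing a given \<open>y\<close> form again
  a cube of side \<open>r\<close>, so Fubini counts each point with weight r^2. This gain at small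
  scales is what makes the later series converge.\<close>

lemma nn_integral_cube_averages:
  assumes w: "w \<in> borel_measurable lebesgue" and r: "0 < r"
  shows "(\<lambda>x. \<integral>\<^sup>+ y. w y * indicator (cube x r) y \<partial>lebesgue) \<in> borel_measurable lebesgue"
    and "(\<integral>\<^sup>+ x. \<integral>\<^sup>+ y. w y * indicator (cube x r) y \<partial>lebesgue \<partial>lebesgue) = ennreal (r\<^sup>2) * (\<integral>\<^sup>+ y. w y \<partial>lebesgue)"
proof -
  interpret sigma_finite_measure "lebesgue :: (real ^ 2) measure" by (rule sigma_finite_lebesgue)
  interpret pair_sigma_finite "lebesgue :: (real ^ 2) measure" "lebesgue :: (real ^ 2) measure" ..
  note w[measurable] measurable_indicator_cube[measurable]
  have m: "(\<lambda>(x, y). w y * indicator (cube x r) y) \<in> borel_measurable (lebesgue \<Otimes>\<^sub>M lebesgue)"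
  proof -
    have "(\<lambda>p. w (snd p) * (case p of (x, y) \<Rightarrow> indicator (cube x r) y)) \<in> borel_measurable (lebesgue \<Otimes>\<^sub>M lebesgue)"
      by measurable
    then show ?thesis by (simp add: case_prod_beta)
  qed
  show "(\<lambda>x. \<integral>\<^sup>+ y. w y * indicator (cube x r) y \<partial>lebesgue) \<in> borel_measurable lebesgue"
    using sigma_finite_measure.borel_measurable_nn_integral[OF sigma_finite_lebesgue m] by simp
  have "(\<integral>\<^sup>+ x. \<integral>\<^sup>+ y. w y * indicator (cube x r) y \<partial>lebesgue \<partial>lebesgue)
      = (\<integral>\<^sup>+ y. \<integral>\<^sup>+ x. w y * indicator (cube x r) y \<partial>lebesgue \<partial>lebesgue)"
    by (rule Fubini'[OF m, symmetric])
  also have "\<dots> = (\<integral>\<^sup>+ y. ennreal (r\<^sup>2) * w y \<partial>lebesgue)"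
  proof (rule nn_integral_cong)
    fix y
    have "y \<in> cube x r \<longleftrightarrow> x \<in> cube (y - r *\<^sub>R One) r" for x
      by (auto simp: mem_cube forall_2)
    then have "(indicator (cube x r) y :: ennreal) = indicator (cube (y - r *\<^sub>R One) r) x" for x
      by (simp add: indicator_def)
    then have "(\<integral>\<^sup>+ x. w y * indicator (cube x r) y \<partial>lebesgue) = w y * emeasure lebesgue (cube (y - r *\<^sub>R One) r)"
      by (simp add: nn_integral_cmult_indicator fmeasurableD del: emeasure_completion)
    also have "emeasure lebesgue (cube (y - r *\<^sub>R One) r) = ennreal (r\<^sup>2)"
      using r by (subst emeasure_eq_measure2) (auto simp: measure_cube fmeasurableD2)
    finally show "(\<integral>\<^sup>+ x. w y * indicator (cube x r) y \<partial>lebesgue) = ennreal (r\<^sup>2) * w y"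
      by (simp add: mult.commute)
  qed
  also have "\<dots> = ennreal (r\<^sup>2) * (\<integral>\<^sup>+ y. w y \<partial>lebesgue)"
    by (intro nn_integral_cmult w)
  finally show "(\<integral>\<^sup>+ x. \<integral>\<^sup>+ y. w y * indicator (cube x r) y \<partial>lebesgue \<partial>lebesgue) = ennreal (r\<^sup>2) * (\<integral>\<^sup>+ y. w y \<partial>lebesgue)" .
qed

section \<open>Averages of functions with square integrable weak gradient in the disk\<close>

definition base_const :: "nat \<Rightarrow> real \<Rightarrow> real \<Rightarrow> real" where
  "base_const N e r = N / kmass * (2 / r) * (measure lebesgue unit_disk + e)"

text \<open>\<open>e\<close> is twice the Dirichlet energy, which carries a factor 1/2; hence the
  \<open>2 * E\<close> in the final constant.\<close>

locale disk_gradient =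
  fixes u :: "real ^ 2 \<Rightarrow> real ^ 'n" and G :: "real ^ 2 \<Rightarrow> real ^ 2 ^ 'n" and e :: real
  assumes weak_gradient: "is_weak_gradient_on unit_disk u G"
    and integrable_u: "integrable (lebesgue_on unit_disk) u"
    and integrable_G2: "integrable (lebesgue_on unit_disk) (\<lambda>y. (norm (G y))\<^sup>2)"
    and energy: "(LINT y|lebesgue_on unit_disk. (norm (G y))\<^sup>2) = e"
begin

lemma e_nonneg: "0 \<le> e"
  unfolding energy[symmetric] by (rule Bochner_Integration.integral_nonneg) simp

lemma integrable_G_cbox:
  assumes "cbox l h \<subseteq> unit_disk"
  shows "integrable (lebesgue_on (cbox l h)) (\<lambda>y. norm (G y))"
    and "integrable (lebesgue_on (cbox l h)) (\<lambda>y. (norm (G y))\<^sup>2)"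
proof -
  show "integrable (lebesgue_on (cbox l h)) (\<lambda>y. norm (G y))"
    using weak_gradient assms
    by (intro integrable_norm) (simp add: is_weak_gradient_on_def locally_integrable_on_def)
  show "integrable (lebesgue_on (cbox l h)) (\<lambda>y. (norm (G y))\<^sup>2)"
    by (rule integrable_lebesgue_on_subset[OF integrable_G2 assms]) simp_all
qed

lemma integral_G_young:
  assumes "cbox l h \<subseteq> unit_disk" "0 < c"
  shows "(LINT y|lebesgue_on (cbox l h). norm (G y))
    \<le> c * measure lebesgue (cbox l h) + (LINT y|lebesgue_on (cbox l h). (norm (G y))\<^sup>2) / c"
proof -
  have young: "norm (G y) \<le> c + (norm (G y))\<^sup>2 / c" for y
  proof (cases "norm (G y) \<le> c")
    case False
    then have "norm (G y) * c \<le> norm (G y) * norm (G y)" by (intro mult_left_mono) auto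
    then have "norm (G y) \<le> (norm (G y))\<^sup>2 / c" using assms(2) by (simp add: field_simps power2_eq_square)
    then show ?thesis using assms(2) by simp
  qed (use assms(2) in \<open>simp add: add_increasing2\<close>)
  have "(LINT y|lebesgue_on (cbox l h). norm (G y)) \<le> (LINT y|lebesgue_on (cbox l h). c + (norm (G y))\<^sup>2 / c)"
    using integrable_G_cbox[OF assms(1)] young by (intro integral_mono) auto
  also have "\<dots> = c * measure lebesgue (cbox l h) + (LINT y|lebesgue_on (cbox l h). (norm (G y))\<^sup>2) / c"
    using integrable_G_cbox(2)[OF assms(1)]
    by (subst Bochner_Integration.integral_add) (auto simp: measure_restrict_space)
  finally show ?thesis .
qed

lemma kavg_diff:
  assumes "cbox l h \<subseteq> unit_disk" "0 < r" "0 < r'" "cube a r \<subseteq> cbox l h" "cube a' r' \<subseteq> cbox l h"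
  shows "norm (kavg u a r - kavg u a' r')
    \<le> CARD('n) / kmass * (1 / r + 1 / r') * (LINT y|lebesgue_on (cbox l h). norm (G y))"
proof -
  have "norm (kavg u a r - kavg u a' r')
      = 1 / kmass * norm ((LINT y|lebesgue. kern a r y *\<^sub>R u y) - (LINT y|lebesgue. kern a' r' y *\<^sub>R u y))"
    using kmass_pos by (simp add: kavg_def flip: scaleR_diff_right)
  also have "\<dots> \<le> 1 / kmass * (CARD('n) * ((1 / r + 1 / r') * (LINT y|lebesgue_on (cbox l h). norm (G y))))"
    using kmass_pos by (intro mult_left_mono weak_gradient_kern_diff[OF weak_gradient _ assms]) auto
  finally show ?thesis by simp
qed

text \<open>A single box spanned by the cubes at \<open>x\<close> and at 0 joins the two averages.
  The estimate serves twice: it allows one constant \<open>kavg u 0 r\<close> in the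
  \<open>L^p\<close> bound for all points, and it handles pairs of distant points in the Hoelder
  estimate.\<close>

lemma kavg_diff_origin:
  assumes r: "0 < r" and x: "norm x + 2 * r < 1"
  shows "norm (kavg u x r - kavg u 0 r) \<le> base_const CARD('n) e r"
proof -
  define l h :: "real ^ 2" where "l = (\<chi> i. min (x $ i) 0)" and "h = (\<chi> i. max (x $ i) 0 + r)"
  have sub: "cbox l h \<subseteq> unit_disk"
  proof
    fix y assume "y \<in> cbox l h"
    then have y: "min (x $ i) 0 \<le> y $ i" "y $ i \<le> max (x $ i) 0 + r" for i
      by (auto simp: mem_box_cart l_def h_def)
    \<comment> \<open>\<open>z\<close> clips each coordinate of \<open>y\<close> to the range
      between 0 and that of \<open>x\<close>; so its norm is at most that of \<open>x\<close>, and
      \<open>y\<close> lies in the cube of side \<open>r\<close> at \<open>z\<close>.\<close>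
    define z :: "real ^ 2" where "z = (\<chi> i. min (y $ i) (max (x $ i) 0))"
    have "norm z \<le> norm x"
    proof (rule norm_le_componentwise_cart)
      show "norm (z $ i) \<le> norm (x $ i)" for i using y[of i] by (auto simp: z_def)
    qed
    moreover have "norm (y - z) \<le> 2 * r"
    proof (rule norm_cube_diff_le)
      show "y \<in> cube z r" using y r by (auto simp: mem_cube z_def min_def)
    qed
    ultimately show "y \<in> unit_disk"
      using x norm_triangle_ineq[of z "y - z"] by simp
  qed
  have bounds: "measure lebesgue (cbox l h) \<le> measure lebesgue unit_disk"
      "(LINT y|lebesgue_on (cbox l h). (norm (G y))\<^sup>2) \<le> e"
    subgoal by (intro measure_mono_fmeasurable sub) auto
    subgoal unfolding energy[symmetric] by (intro integral_mono_lebesgue_on_AE integrable_G2 AE_I2 sub) auto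
    done
  have "norm (kavg u x r - kavg u 0 r)
      \<le> CARD('n) / kmass * (1 / r + 1 / r) * (LINT y|lebesgue_on (cbox l h). norm (G y))"
    using r by (intro kavg_diff sub) (auto simp: mem_cube l_def h_def mem_box_cart forall_2)
  also have "\<dots> \<le> CARD('n) / kmass * (1 / r + 1 / r) * (measure lebesgue unit_disk + e)"
    using integral_G_young[OF sub, of 1] bounds r kmass_pos by (intro mult_left_mono) auto
  finally show ?thesis by (simp add: base_const_def)
qed


text \<open>The cutoff at the disk gives a meaning to cube energies at all centres, so that Fubini
  can run over the whole plane.\<close>

definition energy_density :: "real ^ 2 \<Rightarrow> ennreal" where
  "energy_density y = ennreal (indicator unit_disk y * (norm (G y))\<^sup>2)"

definition cube_energy :: "real \<Rightarrow> real ^ 2 \<Rightarrow> ennreal" where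
  "cube_energy r x = (\<integral>\<^sup>+ y. energy_density y * indicator (cube x r) y \<partial>lebesgue)"

lemma integrable_energy_density: "integrable lebesgue (\<lambda>y. indicator unit_disk y * (norm (G y))\<^sup>2)"
  using integrable_G2 by (subst (asm) integrable_restrict_space) auto

lemma borel_measurable_energy_density: "energy_density \<in> borel_measurable lebesgue"
  unfolding energy_density_def[abs_def]
  using borel_measurable_integrable[OF integrable_energy_density] by (rule measurable_compose) simp

lemma nn_integral_energy_density: "(\<integral>\<^sup>+ y. energy_density y \<partial>lebesgue) = ennreal e"
proof -
  have "(\<integral>\<^sup>+ y. energy_density y \<partial>lebesgue) = ennreal (LINT y|lebesgue. indicator unit_disk y * (norm (G y))\<^sup>2)"
    unfolding energy_density_def by (intro nn_integral_eq_integral integrable_energy_density) simp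
  also have "(LINT y|lebesgue. indicator unit_disk y * (norm (G y))\<^sup>2) = e"
    unfolding energy[symmetric] by (subst integral_restrict_space) auto
  finally show ?thesis .
qed

lemma cube_energy_le: "cube_energy r x \<le> ennreal e"
  unfolding cube_energy_def nn_integral_energy_density[symmetric]
  by (intro nn_integral_mono) (simp add: indicator_def)

lemma cube_energy_finite: "ennreal (enn2real (cube_energy r x)) = cube_energy r x"
  using cube_energy_le[of r x] by (simp add: ennreal_enn2real le_less_trans top.not_eq_extremum)

lemma integral_cube_energy:
  assumes "cube x r \<subseteq> unit_disk"
  shows "(LINT y|lebesgue_on (cube x r). (norm (G y))\<^sup>2) = enn2real (cube_energy r x)"
proof -
  have int: "integrable (lebesgue_on (cube x r)) (\<lambda>y. (norm (G y))\<^sup>2)"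
    using integrable_G_cbox(2) assms by (simp add: cube_def)
  have "ennreal (LINT y|lebesgue_on (cube x r). (norm (G y))\<^sup>2)
      = (\<integral>\<^sup>+ y. ennreal ((norm (G y))\<^sup>2) \<partial>lebesgue_on (cube x r))"
    by (rule nn_integral_eq_integral[symmetric, OF int]) simp
  also have "\<dots> = (\<integral>\<^sup>+ y. ennreal ((norm (G y))\<^sup>2) * indicator (cube x r) y \<partial>lebesgue)"
    by (subst nn_integral_restrict_space) (simp_all add: fmeasurableD)
  also have "\<dots> = cube_energy r x"
    unfolding cube_energy_def energy_density_def
  proof (rule nn_integral_cong)
    fix y
    show "ennreal ((norm (G y))\<^sup>2) * indicator (cube x r) y
        = ennreal (indicator unit_disk y * (norm (G y))\<^sup>2) * indicator (cube x r) y"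
      using subsetD[OF assms, of y] by (cases "y \<in> cube x r") simp_all
  qed
  finally have eq: "ennreal (LINT y|lebesgue_on (cube x r). (norm (G y))\<^sup>2) = cube_energy r x" .
  have "0 \<le> (LINT y|lebesgue_on (cube x r). (norm (G y))\<^sup>2)"
    by (rule Bochner_Integration.integral_nonneg) simp
  then show ?thesis by (simp flip: eq)
qed

text \<open>The free parameter \<open>s\<close> from Young's inequality replaces the Cauchy--Schwarz inequality; it is chosen
  geometrically decaying below.\<close>

lemma kavg_halving:
  assumes r: "0 < r" and sub: "cube x r \<subseteq> unit_disk" and s: "0 < s"
  shows "norm (kavg u x (r / 2) - kavg u x r)
    \<le> 3 * real CARD('n) / kmass * (s + enn2real (cube_energy r x) / s)"
proof -
  let ?I = "LINT y|lebesgue_on (cube x r). norm (G y)"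
  have c: "cube x r = cbox x (x + r *\<^sub>R One)" by (simp add: cube_def)
  have "cube x (r / 2) \<subseteq> cube x r"
    using r by (auto simp: mem_cube forall_2)
  then have "norm (kavg u x (r / 2) - kavg u x r) \<le> CARD('n) / kmass * (1 / (r / 2) + 1 / r) * ?I"
    using r sub unfolding c by (intro kavg_diff) (simp_all add: c)
  also have "\<dots> \<le> CARD('n) / kmass * (1 / (r / 2) + 1 / r) * (s / r * r\<^sup>2 + enn2real (cube_energy r x) / (s / r))"
    using integral_G_young[of x "x + r *\<^sub>R One" "s / r"] r s sub kmass_pos
    unfolding c[symmetric] integral_cube_energy[OF sub] measure_cube[OF r]
    by (intro mult_left_mono) auto
  also have "\<dots> = 3 * real CARD('n) / kmass * (s + enn2real (cube_energy r x) / s)"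
    using r s kmass_pos by (simp add: field_simps power2_eq_square)
  finally show ?thesis .
qed

end

section \<open>The \<open>L^p\<close> bound from energies at dyadic scales\<close>

lemma one_plus_powr_le:
  fixes s p :: real
  assumes "0 \<le> s" "1 \<le> p"
  shows "(1 + s) powr p \<le> 2 powr p * (1 + s powr p)"
proof -
  have "(1 + s) powr p \<le> (2 * max 1 s) powr p"
    using assms by (intro powr_mono2) auto
  also have "\<dots> = 2 powr p * (max 1 s powr p)"
    using assms by (simp add: powr_mult)
  also have "\<dots> \<le> 2 powr p * (1 + s powr p)"
    by (intro mult_left_mono) (auto simp: max_def)
  finally show ?thesis .
qed

text \<open>The denominator \<open>1 - 2 powr (- 1 / (2 * p))\<close> sums the geometric series of
  changes between scales; the leading 2 pays for splitting the power of a sum in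
  \<open>one_plus_powr_le\<close>.\<close>

definition sobolev_const :: "nat \<Rightarrow> real \<Rightarrow> real \<Rightarrow> real \<Rightarrow> real" where
  "sobolev_const N e p r = (2 * (base_const N e r + 3 * N / kmass / (1 - 2 powr (- 1 / (2 * p))))) powr p"

definition lp_const :: "nat \<Rightarrow> real \<Rightarrow> real \<Rightarrow> real \<Rightarrow> real" where
  "lp_const N e p r = sobolev_const N e p r * (measure lebesgue unit_disk + 2 * (e powr (p - 1) * r\<^sup>2 * e))"

context disk_gradient
begin

text \<open>The weight 2^k is a compromise: where the sum is finite it forces the cube energies to
  decay geometrically, yet it loses against the 4^-k gained when these energies are integrated over
  \<open>x\<close>.\<close>

definition dyadic_energy :: "real \<Rightarrow> real \<Rightarrow> real ^ 2 \<Rightarrow> ennreal" where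
  "dyadic_energy p r x = (\<Sum>k. ennreal (2 ^ k * enn2real (cube_energy (r / 2 ^ k) x) powr p))"

lemma cube_subset_disk:
  assumes "norm x + 3 * r < 1" "0 < r"
  shows "cube x r \<subseteq> unit_disk"
proof
  fix y assume "y \<in> cube x r"
  from norm_cube_diff_le[OF this] show "y \<in> unit_disk"
    using assms norm_triangle_ineq[of x "y - x"] by simp
qed

text \<open>The averages at \<open>x\<close> telescope along the scales r / 2^k down to
  \<open>u x\<close>, while the first of them is compared with the average at 0. Finiteness of the
  dyadic energy makes the telescoping sum geometric.\<close>

lemma norm_diff_le_dyadic_energy:
  assumes r: "0 < r" and x: "norm x + 3 * r < 1" and p: "1 \<le> p"
    and lim: "(kavg u x \<longlongrightarrow> u x) (at_right 0)"
    and t: "dyadic_energy p r x = ennreal t" "0 \<le> t"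
  shows "norm (u x - kavg u 0 r) powr p \<le> sobolev_const CARD('n) e p r * (1 + t)"
proof -
  \<comment> \<open>Chosen so that b^(2p) = 1/2: the bound 2^k J^p \<le> t on a single term of the
    dyadic energy then reads J \<le> s (b^k)^2 with s = t^(1/p).\<close>
  define b where "b = 2 powr (- 1 / (2 * p))"
  have b: "0 < b" "b < 1" using p by (auto simp: b_def powr_less_one)
  have e1: "- 1 / (2 * p) * (2 * p) = - 1" using p by simp
  have bp: "b powr (2 * p) = 1 / 2"
    unfolding b_def powr_powr e1 by (rule powr_neg_one) simp
  define M where "M = 3 * real CARD('n) / kmass"
  have M: "0 < M" using kmass_pos by (simp add: M_def)
  define s where "s = t powr (1 / p)"
  have s: "0 \<le> s" "s powr p = t" using t p by (auto simp: s_def powr_powr)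
  have rk: "0 < r / 2 ^ k" "r / 2 ^ k \<le> r" "norm x + 3 * (r / 2 ^ k) < 1" for k
  proof -
    show "0 < r / 2 ^ k" using r by simp
    have "r * 1 \<le> r * 2 ^ k" using r by (intro mult_left_mono) auto
    then show "r / 2 ^ k \<le> r" by (simp add: divide_le_eq)
    then show "norm x + 3 * (r / 2 ^ k) < 1" using x by linarith
  qed
  have energy_k: "enn2real (cube_energy (r / 2 ^ k) x) \<le> s * (b ^ k)\<^sup>2" for k
  proof -
    let ?j = "enn2real (cube_energy (r / 2 ^ k) x)"
    have "(\<Sum>i\<in>{k}. ennreal (2 ^ i * enn2real (cube_energy (r / 2 ^ i) x) powr p)) \<le> dyadic_energy p r x"
      unfolding dyadic_energy_def by (rule sum_le_suminf) simp_all
    then have "ennreal (2 ^ k * ?j powr p) \<le> ennreal t" by (simp only: t(1) sum.insert finite.emptyI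
      empty_iff sum.empty add_0_right simp_thms)
    then have "2 ^ k * ?j powr p \<le> s powr p" using t(2) by (simp only: ennreal_le_iff s(2))
    then have "?j powr p \<le> s powr p / 2 ^ k" by (simp add: pos_le_divide_eq mult.commute)
    then have "?j powr p \<le> s powr p * (1 / 2) ^ k" by (simp only: power_one_over divide_inverse mult_1_left power_inverse)
    also have "(1 / 2) ^ k = ((b ^ k)\<^sup>2) powr p"
    proof -
      have "((b ^ k)\<^sup>2) powr p = (b powr real (k * 2)) powr p"
        by (subst powr_realpow) (simp_all add: b power_mult)
      also have "\<dots> = b powr ((2 * p) * real k)" by (simp add: powr_powr mult.commute mult.left_commute)
      also have "\<dots> = (b powr (2 * p)) ^ k" using b by (simp add: powr_power mult_ac)
      finally show ?thesis by (simp only: bp)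
    qed
    also have "s powr p * ((b ^ k)\<^sup>2) powr p = (s * (b ^ k)\<^sup>2) powr p"
      using s b by (simp add: powr_mult)
    finally have le: "?j powr p \<le> (s * (b ^ k)\<^sup>2) powr p" .
    have "0 \<le> s * (b ^ k)\<^sup>2" using s by simp
    then show ?thesis
      using powr_less_mono2[of p "s * (b ^ k)\<^sup>2" ?j] le p by linarith
  qed
  have step: "norm (kavg u x (r / 2 ^ Suc k) - kavg u x (r / 2 ^ k)) \<le> M * (1 + s) * b ^ k" for k
  proof -
    \<comment> \<open>With b^k as Young parameter both resulting terms are of order b^k.\<close>
    have "norm (kavg u x (r / 2 ^ k / 2) - kavg u x (r / 2 ^ k))
        \<le> 3 * real CARD('n) / kmass * (b ^ k + enn2real (cube_energy (r / 2 ^ k) x) / b ^ k)"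
      using b by (intro kavg_halving cube_subset_disk rk) auto
    also have "\<dots> \<le> M * (b ^ k + s * (b ^ k)\<^sup>2 / b ^ k)"
      unfolding M_def[symmetric] using b M energy_k by (intro mult_left_mono add_mono divide_right_mono) auto
    also have "\<dots> = M * (1 + s) * b ^ k" using b by (simp add: power2_eq_square algebra_simps)
    finally show ?thesis by (simp add: mult.commute)
  qed
  have "filterlim (\<lambda>k :: nat. r / 2 ^ k) (at_right 0) sequentially"
  proof -
    have "(\<lambda>k. r * (1 / 2) ^ k) \<longlonglongrightarrow> r * 0"
      by (intro tendsto_intros LIMSEQ_power_zero) simp
    then show ?thesis
      using r by (auto simp: filterlim_at power_divide intro!: always_eventually)
  qed
  then have "(\<lambda>k. kavg u x (r / 2 ^ k)) \<longlonglongrightarrow> u x"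
    by (rule filterlim_compose[OF lim])
  from geometric_telescope_limit[OF _ b(2) _ _ this, of "M * (1 + s)" 0]
  have "norm (u x - kavg u x r) \<le> M * (1 + s) / (1 - b)"
    using step b M s by simp
  moreover have "norm (kavg u x r - kavg u 0 r) \<le> base_const CARD('n) e r"
    using r x by (intro kavg_diff_origin) auto
  ultimately have "norm (u x - kavg u 0 r) \<le> base_const CARD('n) e r + M / (1 - b) * (1 + s)"
    using norm_triangle_ineq[of "u x - kavg u x r" "kavg u x r - kavg u 0 r"] by simp
  also have "base_const CARD('n) e r \<ge> 0"
    using kmass_pos r e_nonneg by (simp add: base_const_def)
  then have "base_const CARD('n) e r + M / (1 - b) * (1 + s) \<le> (base_const CARD('n) e r + M / (1 - b)) * (1 + s)"
    using s by (simp add: algebra_simps)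
  finally have "norm (u x - kavg u 0 r) powr p \<le> ((base_const CARD('n) e r + M / (1 - b)) * (1 + s)) powr p"
    using p by (intro powr_mono2) auto
  also have "\<dots> = (base_const CARD('n) e r + M / (1 - b)) powr p * (1 + s) powr p"
    by (rule powr_mult)
  also have "\<dots> \<le> (base_const CARD('n) e r + M / (1 - b)) powr p * (2 powr p * (1 + s powr p))"
    using s p by (intro mult_left_mono one_plus_powr_le) auto
  also have "\<dots> = sobolev_const CARD('n) e p r * (1 + t)"
  proof -
    have "sobolev_const CARD('n) e p r = 2 powr p * (base_const CARD('n) e r + M / (1 - b)) powr p"
      unfolding sobolev_const_def M_def b_def by (rule powr_mult)
    then show ?thesis by (simp add: s(2))
  qed
  finally show ?thesis .
qed

text \<open>Bounding J^(p-1) by its value at the total energy leaves one factor J, whose integral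
  over the centres is (r / 2^k)^2 e. Against the weight 2^k this leaves 2^-k, and the series
  contributes the factor 2.\<close>

lemma nn_integral_dyadic_energy:
  assumes r: "0 < r" and p: "1 \<le> p"
  shows "dyadic_energy p r \<in> borel_measurable lebesgue"
    and "(\<integral>\<^sup>+ x. dyadic_energy p r x \<partial>lebesgue) \<le> ennreal (2 * (e powr (p - 1) * r\<^sup>2 * e))"
proof -
  define f where "f = (\<lambda>k x. ennreal (2 ^ k * enn2real (cube_energy (r / 2 ^ k) x) powr p))"
  have D: "dyadic_energy p r = (\<lambda>x. \<Sum>k. f k x)" by (simp add: dyadic_energy_def f_def fun_eq_iff)
  have J[measurable]: "cube_energy (r / 2 ^ k) \<in> borel_measurable lebesgue" for k
    unfolding cube_energy_def[abs_def]
    by (rule nn_integral_cube_averages(1)[OF borel_measurable_energy_density]) (use r in simp)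
  have f[measurable]: "f k \<in> borel_measurable lebesgue" for k
    unfolding f_def by measurable
  show "dyadic_energy p r \<in> borel_measurable lebesgue" unfolding D by measurable
  have fint: "(\<integral>\<^sup>+ x. f k x \<partial>lebesgue) \<le> ennreal (e powr (p - 1) * r\<^sup>2 * e * (1 / 2) ^ k)" for k
  proof -
    have "f k x \<le> ennreal (2 ^ k * e powr (p - 1)) * cube_energy (r / 2 ^ k) x" for x
    proof -
      let ?j = "enn2real (cube_energy (r / 2 ^ k) x)"
      have j: "0 \<le> ?j" "?j \<le> e"
        by (rule enn2real_nonneg) (rule enn2real_leI[OF e_nonneg cube_energy_le])
      have "?j powr p = ?j powr (p - 1) * ?j"
        using j by (cases "?j = 0") (auto simp: powr_diff)
      also have "\<dots> \<le> e powr (p - 1) * ?j"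
        using j p by (intro mult_right_mono powr_mono2) auto
      finally have "2 ^ k * ?j powr p \<le> 2 ^ k * e powr (p - 1) * ?j" by simp
      then have "f k x \<le> ennreal (2 ^ k * e powr (p - 1) * ?j)"
        unfolding f_def by (rule ennreal_leI)
      also have "\<dots> = ennreal (2 ^ k * e powr (p - 1)) * ennreal ?j"
        using j by (intro ennreal_mult) auto
      finally show ?thesis by (simp add: cube_energy_finite)
    qed
    then have "(\<integral>\<^sup>+ x. f k x \<partial>lebesgue) \<le> (\<integral>\<^sup>+ x. ennreal (2 ^ k * e powr (p - 1)) * cube_energy (r / 2 ^ k) x \<partial>lebesgue)"
      by (intro nn_integral_mono)
    also have "\<dots> = ennreal (2 ^ k * e powr (p - 1)) * (\<integral>\<^sup>+ x. cube_energy (r / 2 ^ k) x \<partial>lebesgue)"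
      by (intro nn_integral_cmult J)
    also have "(\<integral>\<^sup>+ x. cube_energy (r / 2 ^ k) x \<partial>lebesgue) = ennreal ((r / 2 ^ k)\<^sup>2) * ennreal e"
      unfolding cube_energy_def nn_integral_energy_density[symmetric]
      by (rule nn_integral_cube_averages(2)[OF borel_measurable_energy_density]) (use r in simp)
    also have "ennreal (2 ^ k * e powr (p - 1)) * (ennreal ((r / 2 ^ k)\<^sup>2) * ennreal e)
        = ennreal (2 ^ k * e powr (p - 1) * ((r / 2 ^ k)\<^sup>2 * e))"
      using e_nonneg by (simp add: ennreal_mult)
    also have "2 ^ k * e powr (p - 1) * ((r / 2 ^ k)\<^sup>2 * e) = e powr (p - 1) * r\<^sup>2 * e * (1 / 2) ^ k"
      by (simp add: power_divide power2_eq_square)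
    finally show ?thesis .
  qed
  have "(\<integral>\<^sup>+ x. dyadic_energy p r x \<partial>lebesgue) = (\<Sum>k. \<integral>\<^sup>+ x. f k x \<partial>lebesgue)"
    unfolding D by (rule nn_integral_suminf) measurable
  also have "\<dots> \<le> (\<Sum>k. ennreal (e powr (p - 1) * r\<^sup>2 * e * (1 / 2) ^ k))"
    using fint by (intro suminf_le) auto
  also have "\<dots> = ennreal (\<Sum>k. e powr (p - 1) * r\<^sup>2 * e * (1 / 2) ^ k)"
    using e_nonneg by (intro suminf_ennreal2 summable_mult summable_geometric) auto
  also have "(\<Sum>k. e powr (p - 1) * r\<^sup>2 * e * (1 / 2) ^ k) = 2 * (e powr (p - 1) * r\<^sup>2 * e)"
    by (subst suminf_mult) (auto simp: suminf_geometric intro!: summable_geometric)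
  finally show "(\<integral>\<^sup>+ x. dyadic_energy p r x \<partial>lebesgue) \<le> ennreal (2 * (e powr (p - 1) * r\<^sup>2 * e))" .
qed

lemma nn_integral_norm_powr_le:
  assumes r: "0 < r" and p: "1 \<le> p"
  shows "(\<integral>\<^sup>+ x. ennreal (norm (u x - kavg u 0 r) powr p) \<partial>lebesgue_on (ball 0 (1 - 3 * r))) \<le> ennreal (lp_const CARD('n) e p r)"
proof -
  let ?S = "ball 0 (1 - 3 * r) :: (real ^ 2) set"
  have S: "?S \<in> sets lebesgue" "unit_disk \<in> sets lebesgue" "?S \<subseteq> unit_disk" using r by auto
  have "AE x in lebesgue_on ?S. (kavg u x \<longlongrightarrow> u x) (at_right 0)"
  proof -
    have "AE x in lebesgue. x \<in> unit_disk \<longrightarrow> (kavg u x \<longlongrightarrow> u x) (at_right 0)"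
      using AE_kavg_tendsto[OF open_ball integrable_u] by (simp add: AE_restrict_space_iff)
    then have "AE x in lebesgue. x \<in> ?S \<longrightarrow> (kavg u x \<longlongrightarrow> u x) (at_right 0)"
      by (rule eventually_mono) (use S(3) in blast)
    then show ?thesis by (simp add: AE_restrict_space_iff)
  qed
  then have "AE x in lebesgue_on ?S. ennreal (norm (u x - kavg u 0 r) powr p)
      \<le> ennreal (sobolev_const CARD('n) e p r) * (1 + dyadic_energy p r x)"
    using AE_space
  proof eventually_elim
    case (elim x)
    then have x: "norm x + 3 * r < 1" by (simp add: space_restrict_space)
    show ?case
    proof (cases "dyadic_energy p r x")
      case (real t)
      have "ennreal (norm (u x - kavg u 0 r) powr p) \<le> ennreal (sobolev_const CARD('n) e p r * (1 + t))"
        using norm_diff_le_dyadic_energy[OF r x p _ real(2,1)] elim(1) by (intro ennreal_leI) blast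
      then show ?thesis using real by (simp add: ennreal_mult sobolev_const_def flip: ennreal_1)
    next
      \<comment> \<open>Since 0 times infinity is 0 in \<open>ennreal\<close>, the claim at infinite
        dyadic energy rests on \<open>sobolev_const\<close> being strictly positive.\<close>
      case top
      have "2 powr (- 1 / (2 * p)) < (1 :: real)" using p by (simp add: powr_less_one)
      then have "0 < 3 * real CARD('n) / kmass / (1 - 2 powr (- 1 / (2 * p)))" using kmass_pos by simp
      moreover have "0 \<le> base_const CARD('n) e r" using kmass_pos r e_nonneg by (simp add: base_const_def)
      ultimately have "0 < 2 * (base_const CARD('n) e r + 3 * real CARD('n) / kmass / (1 - 2 powr (- 1 / (2 * p))))"
        by (intro mult_pos_pos add_nonneg_pos) simp_all
      then have "0 < sobolev_const CARD('n) e p r"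
        unfolding sobolev_const_def powr_gt_zero by (rule less_imp_neq[symmetric])
      then show ?thesis using top by (simp add: ennreal_mult_top)
    qed
  qed
  then have "(\<integral>\<^sup>+ x. ennreal (norm (u x - kavg u 0 r) powr p) \<partial>lebesgue_on ?S)
      \<le> (\<integral>\<^sup>+ x. ennreal (sobolev_const CARD('n) e p r) * (1 + dyadic_energy p r x) \<partial>lebesgue_on ?S)"
    by (rule nn_integral_mono_AE)
  also have "\<dots> = (\<integral>\<^sup>+ x. ennreal (sobolev_const CARD('n) e p r) * (1 + dyadic_energy p r x) * indicator ?S x \<partial>lebesgue)"
    using S by (subst nn_integral_restrict_space) auto
  also have "\<dots> \<le> (\<integral>\<^sup>+ x. ennreal (sobolev_const CARD('n) e p r) * (indicator unit_disk x + dyadic_energy p r x) \<partial>lebesgue)"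
    using S(3) by (intro nn_integral_mono) (auto simp: indicator_def)
  also have "\<dots> = ennreal (sobolev_const CARD('n) e p r) * (emeasure lebesgue unit_disk + (\<integral>\<^sup>+ x. dyadic_energy p r x \<partial>lebesgue))"
  proof -
    note m = nn_integral_dyadic_energy(1)[OF r p]
    have i: "(indicator unit_disk :: _ \<Rightarrow> ennreal) \<in> borel_measurable lebesgue"
      by (rule borel_measurable_indicator) (rule S(2))
    have "(\<integral>\<^sup>+ x. ennreal (sobolev_const CARD('n) e p r) * (indicator unit_disk x + dyadic_energy p r x) \<partial>lebesgue)
        = ennreal (sobolev_const CARD('n) e p r) * (\<integral>\<^sup>+ x. indicator unit_disk x + dyadic_energy p r x \<partial>lebesgue)"
      by (intro nn_integral_cmult borel_measurable_add i m)
    also have "(\<integral>\<^sup>+ x. indicator unit_disk x + dyadic_energy p r x \<partial>lebesgue)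
        = (\<integral>\<^sup>+ x. indicator unit_disk x \<partial>lebesgue) + (\<integral>\<^sup>+ x. dyadic_energy p r x \<partial>lebesgue)"
      by (intro nn_integral_add i m)
    finally show ?thesis by (simp only: nn_integral_indicator[OF S(2)])
  qed
  also have "\<dots> \<le> ennreal (sobolev_const CARD('n) e p r) * (ennreal (measure lebesgue unit_disk) + ennreal (2 * (e powr (p - 1) * r\<^sup>2 * e)))"
    using nn_integral_dyadic_energy(2)[OF r p]
    by (intro mult_left_mono add_mono) (auto simp: emeasure_eq_measure2 simp del: emeasure_completion)
  also have "\<dots> = ennreal (lp_const CARD('n) e p r)"
  proof -
    have nn: "0 \<le> sobolev_const CARD('n) e p r" "0 \<le> measure lebesgue unit_disk" "0 \<le> 2 * (e powr (p - 1) * r\<^sup>2 * e)"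
      using e_nonneg by (auto simp: sobolev_const_def)
    show ?thesis
      unfolding lp_const_def ennreal_plus[OF nn(2,3), symmetric]
      by (rule ennreal_mult[symmetric]) (use nn in linarith)+
  qed
  finally show ?thesis .
qed

end

section \<open>Iterating the decay estimate\<close>

lemma emeasure_disk: "0 \<le> r \<Longrightarrow> emeasure lebesgue (ball (x :: real ^ 2) r) = ennreal (pi * r\<^sup>2)"
  using emeasure_ball[of r x] by (simp add: unit_ball_vol_2)

lemma osc_disk:
  assumes "0 < r"
  shows "osc p v (ball (x :: real ^ 2) r)
    = (INF c. (\<integral>\<^sup>+ y. ennreal (norm (v y - c) powr p) \<partial>lebesgue_on (ball x r)) * ennreal (1 / (pi * r\<^sup>2)))"
proof -
  have "a / emeasure lebesgue (ball x r) = a * ennreal (1 / (pi * r\<^sup>2))" for a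
    using assms emeasure_disk[of r x]
    by (simp add: divide_ennreal_def inverse_ennreal inverse_eq_divide del: emeasure_completion)
  then show ?thesis unfolding osc_def by presburger
qed

lemma AE_lebesgue_on_subset:
  assumes "AE x in lebesgue_on S. P x" "T \<subseteq> S" "S \<in> sets lebesgue" "T \<in> sets lebesgue"
  shows "AE x in lebesgue_on T. P x"
proof -
  have "AE x in lebesgue. x \<in> S \<longrightarrow> P x" using assms by (simp add: AE_restrict_space_iff)
  then have "AE x in lebesgue. x \<in> T \<longrightarrow> P x" by (rule eventually_mono) (use assms(2) in blast)
  then show ?thesis using assms by (simp add: AE_restrict_space_iff)
qed

lemma osc_ae_cong:
  assumes "ae_eq_on U v w" "B \<subseteq> U" "U \<in> sets lebesgue" "B \<in> sets lebesgue"
  shows "osc p v B = osc p w B"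
proof -
  have "AE x in lebesgue_on B. v x = w x"
    using assms AE_lebesgue_on_subset unfolding ae_eq_on_def by blast
  then have "(\<integral>\<^sup>+ y. ennreal (norm (v y - c) powr p) \<partial>lebesgue_on B)
      = (\<integral>\<^sup>+ y. ennreal (norm (w y - c) powr p) \<partial>lebesgue_on B)" for c
    by (intro nn_integral_cong_AE) (auto elim: eventually_mono)
  then show ?thesis by (simp add: osc_def)
qed

lemma nn_integral_disk_rescale:
  fixes h :: "real ^ 2 \<Rightarrow> ennreal"
  assumes h: "h \<in> borel_measurable (lebesgue_on (ball x (R * s)))" and R: "0 < R"
  shows "(\<integral>\<^sup>+ y. h y \<partial>lebesgue_on (ball x (R * s))) = ennreal (R\<^sup>2) * (\<integral>\<^sup>+ y. h (x + R *\<^sub>R y) \<partial>lebesgue_on (ball 0 s))"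
proof -
  let ?B = "ball x (R * s)"
  have m: "(\<lambda>y. h y * indicator ?B y) \<in> borel_measurable lebesgue"
    using h by (subst (asm) borel_measurable_restrict_space_iff_ennreal) auto
  have mem: "x + R *\<^sub>R y \<in> ?B \<longleftrightarrow> y \<in> ball 0 s" for y
    using R by (simp add: dist_norm)
  have "(\<integral>\<^sup>+ y. h y \<partial>lebesgue_on ?B) = (\<integral>\<^sup>+ y. h y * indicator ?B y \<partial>lebesgue)"
    by (subst nn_integral_restrict_space) auto
  also have "\<dots> = ennreal (R\<^sup>2) * (\<integral>\<^sup>+ y. h (x + R *\<^sub>R y) * indicator ?B (x + R *\<^sub>R y) \<partial>lebesgue)"
    using nn_integral_affine_lebesgue[OF m R, of x] by simp
  also have "(\<integral>\<^sup>+ y. h (x + R *\<^sub>R y) * indicator ?B (x + R *\<^sub>R y) \<partial>lebesgue)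
      = (\<integral>\<^sup>+ y. h (x + R *\<^sub>R y) * indicator (ball 0 s) y \<partial>lebesgue)"
    using mem by (intro nn_integral_cong) (simp add: indicator_def del: mem_ball)
  also have "\<dots> = (\<integral>\<^sup>+ y. h (x + R *\<^sub>R y) \<partial>lebesgue_on (ball 0 s))"
    by (subst nn_integral_restrict_space) auto
  finally show ?thesis .
qed

lemma osc_rescale:
  assumes u: "u \<in> borel_measurable (lebesgue_on (ball x (R * s)))" and R: "0 < R" and s: "0 < s"
  shows "osc p (\<lambda>y. u (x + R *\<^sub>R y)) (ball 0 s) = osc p u (ball (x :: real ^ 2) (R * s))"
proof -
  have "(\<integral>\<^sup>+ y. ennreal (norm (u y - c) powr p) \<partial>lebesgue_on (ball x (R * s))) * ennreal (1 / (pi * (R * s)\<^sup>2))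
      = (\<integral>\<^sup>+ y. ennreal (norm (u (x + R *\<^sub>R y) - c) powr p) \<partial>lebesgue_on (ball 0 s)) * ennreal (1 / (pi * s\<^sup>2))" for c
  proof -
    have "(\<lambda>y. ennreal (norm (u y - c) powr p)) \<in> borel_measurable (lebesgue_on (ball x (R * s)))"
      using u by measurable
    note * = nn_integral_disk_rescale[OF this R]
    have **: "ennreal (R\<^sup>2) * ennreal (1 / (pi * (R * s)\<^sup>2)) = ennreal (1 / (pi * s\<^sup>2))"
      using R by (simp add: power_mult_distrib flip: ennreal_mult)
    have "ennreal (R\<^sup>2) * X * ennreal (1 / (pi * (R * s)\<^sup>2)) = X * (ennreal (R\<^sup>2) * ennreal (1 / (pi * (R * s)\<^sup>2)))" for X
      by (simp only: ac_simps)
    then show ?thesis unfolding * by (simp only: **)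
  qed
  then show ?thesis using R s by (simp add: osc_disk)
qed

text \<open>The prefactor R^2 contributes R^(2q) to the q-th power and the change of variables
  divides by R^2; the q-th root leaves the exponent 2 - 2/q. This is the origin of the second
  threshold for \<eta>.\<close>

lemma Lp_norm_rescale_le:
  fixes f g :: "real ^ 2 \<Rightarrow> 'b::euclidean_space"
  assumes f: "f \<in> Lp_on q unit_disk" and g: "g \<in> Lp_on q unit_disk" and q: "1 < q"
    and R: "0 < R" "ball x R \<subseteq> unit_disk"
    and eq: "ae_eq_on unit_disk g (\<lambda>y. R\<^sup>2 *\<^sub>R f (x + R *\<^sub>R y))"
  shows "Lp_norm_on q unit_disk g \<le> R powr (2 - 2 / q) * Lp_norm_on q unit_disk f"
proof -
  let ?F = "LINT y|lebesgue_on unit_disk. norm (f y) powr q"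
  let ?I = "LINT y|lebesgue_on unit_disk. norm (g y) powr q"
  have fm: "f \<in> borel_measurable (lebesgue_on unit_disk)"
    and fi: "integrable (lebesgue_on unit_disk) (\<lambda>y. norm (f y) powr q)"
    and gi: "integrable (lebesgue_on unit_disk) (\<lambda>y. norm (g y) powr q)"
    using f g by (auto simp: Lp_on_def)
  have fR: "(\<lambda>y. ennreal (norm (f y) powr q)) \<in> borel_measurable (lebesgue_on (ball x R))"
    using measurable_restrict_mono[OF borel_measurable_integrable[OF fi] R(2)] by measurable
  have nnF: "0 \<le> ?F" "0 \<le> ?I" by (auto intro!: Bochner_Integration.integral_nonneg)
  have scale: "norm (R\<^sup>2 *\<^sub>R z) powr q = R powr (2 * q) * norm z powr q" for z :: 'b
    using R by (simp add: powr_mult powr_powr flip: powr_numeral)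
  let ?h = "\<lambda>y. ennreal (R powr (2 * q)) * ennreal (norm (f y) powr q)"
  have "ennreal ?I = (\<integral>\<^sup>+ y. ennreal (norm (g y) powr q) \<partial>lebesgue_on unit_disk)"
    by (rule nn_integral_eq_integral[symmetric, OF gi]) simp
  also have "\<dots> = (\<integral>\<^sup>+ y. ?h (x + R *\<^sub>R y) \<partial>lebesgue_on unit_disk)"
  proof (rule nn_integral_cong_AE)
    show "AE y in lebesgue_on unit_disk. ennreal (norm (g y) powr q) = ?h (x + R *\<^sub>R y)"
      using eq[unfolded ae_eq_on_def] by eventually_elim (simp add: scale ennreal_mult del: norm_scaleR)
  qed
  finally have "ennreal (R\<^sup>2) * ennreal ?I = (\<integral>\<^sup>+ y. ?h y \<partial>lebesgue_on (ball x (R * 1)))"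
    using fR by (subst nn_integral_disk_rescale) (use R in auto)
  also have "\<dots> = ennreal (R powr (2 * q)) * (\<integral>\<^sup>+ y. ennreal (norm (f y) powr q) \<partial>lebesgue_on (ball x R))"
    using nn_integral_cmult[OF fR] by simp
  also have "\<dots> \<le> ennreal (R powr (2 * q)) * (\<integral>\<^sup>+ y. ennreal (norm (f y) powr q) \<partial>lebesgue_on unit_disk)"
  proof (rule mult_left_mono)
    have "(\<integral>\<^sup>+ y. ennreal (norm (f y) powr q) \<partial>lebesgue_on (ball x R))
        = (\<integral>\<^sup>+ y. ennreal (norm (f y) powr q) * indicator (ball x R) y \<partial>lebesgue)"
      by (subst nn_integral_restrict_space) auto
    also have "\<dots> \<le> (\<integral>\<^sup>+ y. ennreal (norm (f y) powr q) * indicator unit_disk y \<partial>lebesgue)"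
      using R(2) by (intro nn_integral_mono mult_left_mono) (auto simp: indicator_def simp del: mem_ball)
    also have "\<dots> = (\<integral>\<^sup>+ y. ennreal (norm (f y) powr q) \<partial>lebesgue_on unit_disk)"
      by (subst nn_integral_restrict_space) auto
    finally show "(\<integral>\<^sup>+ y. ennreal (norm (f y) powr q) \<partial>lebesgue_on (ball x R))
        \<le> (\<integral>\<^sup>+ y. ennreal (norm (f y) powr q) \<partial>lebesgue_on unit_disk)" .
  qed simp
  also have "(\<integral>\<^sup>+ y. ennreal (norm (f y) powr q) \<partial>lebesgue_on unit_disk) = ennreal ?F"
    by (rule nn_integral_eq_integral[OF fi]) simp
  finally have "R\<^sup>2 * ?I \<le> R powr (2 * q) * ?F"
    using R nnF by (simp flip: ennreal_mult)
  then have "?I \<le> R powr (2 * q - 2) * ?F"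
    using R by (simp add: powr_diff field_simps)
  then have "?I powr (1 / q) \<le> (R powr (2 * q - 2) * ?F) powr (1 / q)"
    using q nnF by (intro powr_mono2) auto
  also have "\<dots> = R powr (2 - 2 / q) * ?F powr (1 / q)"
    using q R by (simp add: powr_mult powr_powr diff_divide_distrib)
  finally show ?thesis by (simp add: Lp_norm_on_def)
qed

text \<open>Closure under rescaling yields only some representative \<open>(v, g)\<close> of the
  rescaled pair; the decay is applied to it on the unit disk and carried back to \<open>u\<close>,
  because \<open>osc\<close> ignores null sets.\<close>

lemma osc_decay_rescaled:
  fixes S :: "((real ^ 2 \<Rightarrow> real ^ 'n) \<times> (real ^ 2 \<Rightarrow> real ^ 'n)) set"
  assumes S: "S \<subseteq> H1_on unit_disk \<times> Lp_on q unit_disk" "rescaling_closed S" "osc_decay q \<theta> \<gamma> \<kappa> p S"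
    and q: "1 < q" and \<theta>: "0 < \<theta>" "\<theta> < 1" and p: "1 \<le> p" and \<kappa>: "0 < \<kappa>"
    and uf: "(u, f) \<in> S" and R: "0 < R" "ball x R \<subseteq> unit_disk"
  shows "osc p u (ball x (\<theta> * R)) \<le> ennreal \<gamma> * osc p u (ball x R)
    + ennreal (\<kappa> * (R powr (2 - 2 / q) * Lp_norm_on q unit_disk f) powr p)"
proof -
  obtain v g where vg: "(v, g) \<in> S" and v: "ae_eq_on unit_disk v (\<lambda>y. u (x + R *\<^sub>R y))"
    and g: "ae_eq_on unit_disk g (\<lambda>y. R\<^sup>2 *\<^sub>R f (x + R *\<^sub>R y))"
    using S(2) uf R unfolding rescaling_closed_def by blast
  have f_Lp: "f \<in> Lp_on q unit_disk" and g_Lp: "g \<in> Lp_on q unit_disk"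
    and u_m: "u \<in> borel_measurable (lebesgue_on unit_disk)"
    using S(1) uf vg by (auto simp: H1_on_def Lp_on_def)
  have scale: "osc p v (ball 0 s) = osc p u (ball x (R * s))" if "0 < s" "s \<le> 1" for s
  proof -
    have "R * s \<le> R * 1" using that R by (intro mult_left_mono) auto
    then have "ball x (R * s) \<subseteq> unit_disk" using R(2) subset_ball[of "R * s" R x] by simp
    then have "u \<in> borel_measurable (lebesgue_on (ball x (R * s)))"
      by (rule measurable_restrict_mono[OF u_m])
    moreover have "osc p v (ball 0 s) = osc p (\<lambda>y. u (x + R *\<^sub>R y)) (ball 0 s)"
      using that by (intro osc_ae_cong[OF v]) auto
    ultimately show ?thesis using osc_rescale R that by metis
  qed
  have "osc p v (ball 0 \<theta>) \<le> ennreal \<gamma> * osc p v unit_disk + ennreal (\<kappa> * Lp_norm_on q unit_disk g powr p)"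
    using S(3) vg unfolding osc_decay_def by blast
  also have "\<kappa> * Lp_norm_on q unit_disk g powr p \<le> \<kappa> * (R powr (2 - 2 / q) * Lp_norm_on q unit_disk f) powr p"
    using Lp_norm_rescale_le[OF f_Lp g_Lp q R g] p \<kappa>
    by (intro mult_left_mono powr_mono2) (auto simp: Lp_norm_on_def)
  finally show ?thesis
    using \<theta> scale[of \<theta>] scale[of 1]
    by (simp add: mult.commute ennreal_leI add_left_mono order.trans)
qed

text \<open>Both thresholds enter here: \<gamma> < \<open>\<theta> powr (\<eta> * p)\<close> leaves
  a gap that absorbs the inhomogeneity, and \<eta> \<le> 2 - 2/q lets the inhomogeneity decay at
  least at the desired rate.\<close>

lemma osc_decay_iterated:
  fixes S :: "((real ^ 2 \<Rightarrow> real ^ 'n) \<times> (real ^ 2 \<Rightarrow> real ^ 'n)) set"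
  assumes S: "S \<subseteq> H1_on unit_disk \<times> Lp_on q unit_disk" "rescaling_closed S" "osc_decay q \<theta> \<gamma> \<kappa> p S"
    and q: "1 < q" and \<theta>: "0 < \<theta>" "\<theta> < 1" and p: "1 \<le> p" and \<kappa>: "0 < \<kappa>" and \<gamma>: "0 < \<gamma>"
    and \<eta>: "0 < \<eta>" "\<gamma> < \<theta> powr (\<eta> * p)" "\<eta> \<le> 2 - 2 / q"
    and uf: "(u, f) \<in> S" and R: "0 < R" "R \<le> 1" "ball x R \<subseteq> unit_disk"
    and A0: "osc p u (ball x R) \<le> ennreal A0" "0 \<le> A0"
  shows "osc p u (ball x (\<theta> ^ k * R))
    \<le> ennreal ((A0 + \<kappa> * Lp_norm_on q unit_disk f powr p / (\<theta> powr (\<eta> * p) - \<gamma>)) * (\<theta> powr (\<eta> * p)) ^ k)"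
proof -
  define F where "F = Lp_norm_on q unit_disk f"
  define \<beta> where "\<beta> = \<theta> powr (\<eta> * p)"
  \<comment> \<open>The second summand solves \<gamma> A + \<kappa> F^p = \<beta> A; adding
    \<open>A0\<close> covers the start of the induction and keeps the inequality that the step
    uses.\<close>
  define A where "A = A0 + \<kappa> * F powr p / (\<beta> - \<gamma>)"
  have F: "0 \<le> F" by (simp add: F_def Lp_norm_on_def)
  have \<beta>: "0 < \<beta>" "\<gamma> < \<beta>" using \<theta> \<eta> by (auto simp: \<beta>_def)
  have A: "0 \<le> A" "A0 \<le> A" "\<gamma> * A + \<kappa> * F powr p \<le> A * \<beta>"
  proof -
    have *: "0 \<le> \<kappa> * F powr p / (\<beta> - \<gamma>)" using \<kappa> \<beta> by auto
    then show "0 \<le> A" "A0 \<le> A" using A0 by (auto simp: A_def)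
    have "\<kappa> * F powr p = \<kappa> * F powr p / (\<beta> - \<gamma>) * (\<beta> - \<gamma>)" using \<beta> by simp
    also have "\<dots> \<le> A * (\<beta> - \<gamma>)" using A0 \<beta> by (intro mult_right_mono) (auto simp: A_def)
    finally show "\<gamma> * A + \<kappa> * F powr p \<le> A * \<beta>" by (simp add: algebra_simps)
  qed
  have "osc p u (ball x (\<theta> ^ k * R)) \<le> ennreal (A * \<beta> ^ k)"
  proof (induction k)
    case 0
    then show ?case using A0 A by (auto intro: order.trans ennreal_leI)
  next
    case (Suc k)
    define r where "r = \<theta> ^ k * R"
    have tk: "0 < \<theta> ^ k" "\<theta> ^ k \<le> 1" using \<theta> by (auto simp: power_le_one)
    then have "r \<le> \<theta> ^ k" "0 < r" using R by (auto simp: r_def)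
    have "r \<le> R" using tk R by (simp add: r_def)
    then have sub: "ball x r \<subseteq> unit_disk" using R(3) subset_ball by blast
    have "(r powr (2 - 2 / q) * F) powr p = r powr ((2 - 2 / q) * p) * F powr p"
      by (simp add: powr_mult powr_powr)
    also have "\<dots> \<le> \<beta> ^ k * F powr p"
    proof (rule mult_right_mono)
      \<comment> \<open>Here the bound \<open>R \<le> 1\<close> matters: the base is at most 1, so
        the exponent may be lowered from 2 - 2/q to \<eta>.\<close>
      have "r powr ((2 - 2 / q) * p) \<le> r powr (\<eta> * p)"
        using \<open>0 < r\<close> \<open>r \<le> \<theta> ^ k\<close> tk \<eta> p by (intro powr_mono') (auto intro!: mult_right_mono)
      also have "\<dots> \<le> (\<theta> ^ k) powr (\<eta> * p)"
        using \<open>0 < r\<close> \<open>r \<le> \<theta> ^ k\<close> \<eta> p by (intro powr_mono2) auto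
      also have "\<dots> = \<beta> ^ k"
        using \<theta> by (simp add: \<beta>_def powr_realpow[symmetric] powr_powr mult.commute)
      finally show "r powr ((2 - 2 / q) * p) \<le> \<beta> ^ k" .
    qed simp
    finally have F_le: "\<kappa> * (r powr (2 - 2 / q) * F) powr p \<le> \<kappa> * (\<beta> ^ k * F powr p)"
      using \<kappa> by (intro mult_left_mono) auto
    have "osc p u (ball x (\<theta> * r)) \<le> ennreal \<gamma> * osc p u (ball x r) + ennreal (\<kappa> * (r powr (2 - 2 / q) * F) powr p)"
      unfolding F_def by (rule osc_decay_rescaled[OF S q \<theta> p \<kappa> uf \<open>0 < r\<close> sub])
    also have "\<dots> \<le> ennreal \<gamma> * ennreal (A * \<beta> ^ k) + ennreal (\<kappa> * (\<beta> ^ k * F powr p))"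
      using Suc unfolding r_def[symmetric] by (intro add_mono[OF mult_left_mono ennreal_leI[OF F_le]]) auto
    also have "\<dots> = ennreal ((\<gamma> * A + \<kappa> * F powr p) * \<beta> ^ k)"
      using \<gamma> A \<beta> \<kappa> by (simp add: algebra_simps flip: ennreal_mult ennreal_plus)
    also have "\<dots> \<le> ennreal (A * \<beta> * \<beta> ^ k)"
      using A \<beta> by (intro ennreal_leI mult_right_mono) auto
    finally show ?case by (simp add: r_def mult_ac)
  qed
  then show ?thesis by (simp add: A_def F_def \<beta>_def)
qed

section \<open>From decay to Hoelder continuity\<close>

lemma power_bracket:
  fixes \<theta> t :: real
  assumes "0 < \<theta>" "\<theta> < 1" "0 < t" "t < 1"
  shows "\<exists>k. \<theta> ^ Suc k \<le> t \<and> t < \<theta> ^ k"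
proof -
  define n where "n = (LEAST n. \<theta> ^ n \<le> t)"
  have "\<exists>n. \<theta> ^ n \<le> t" using real_arch_pow_inv[OF assms(3,2)] less_imp_le by blast
  then have n: "\<theta> ^ n \<le> t" unfolding n_def by (rule LeastI_ex)
  then obtain k where k: "n = Suc k" using assms(4) by (cases n) auto
  have "\<not> \<theta> ^ k \<le> t" using not_less_Least[of k "\<lambda>n. \<theta> ^ n \<le> t"] k unfolding n_def by simp
  then show ?thesis using n k by auto
qed

text \<open>The limit is taken along all radii, not only along \<theta>^k \<rho>, so the hypothesis
  controls the whole range between consecutive scales. Each smaller radius falls into one such range
  by \<open>power_bracket\<close>.\<close>

lemma scale_limit:
  fixes g :: "real \<Rightarrow> 'a::banach"
  assumes \<theta>: "0 < \<theta>" "\<theta> < 1" and b: "0 < b" "b < 1" and \<rho>: "0 < \<rho>" and C: "0 \<le> C"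
    and H: "\<And>k s. \<theta> ^ Suc k * \<rho> \<le> s \<Longrightarrow> s \<le> \<theta> ^ k * \<rho> \<Longrightarrow> norm (g s - g (\<theta> ^ k * \<rho>)) \<le> C * b ^ k"
  shows "\<exists>L. (g \<longlongrightarrow> L) (at_right 0) \<and> (\<forall>k. norm (L - g (\<theta> ^ k * \<rho>)) \<le> C * b ^ k / (1 - b))"
proof -
  define V where "V = (\<lambda>k. g (\<theta> ^ k * \<rho>))"
  have step: "norm (V (Suc k) - V k) \<le> C * b ^ k" for k
  proof -
    have "\<theta> ^ Suc k * \<rho> \<le> \<theta> ^ k * \<rho>" using \<theta> \<rho> by (intro mult_right_mono power_decreasing) auto
    then show ?thesis unfolding V_def by (intro H) auto
  qed
  have small: "\<exists>k. C * b ^ k * K < e" if "0 < e" "0 \<le> K" for e K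
  proof -
    have "(\<lambda>k. C * b ^ k * K) \<longlonglongrightarrow> C * 0 * K"
      using b by (intro tendsto_intros LIMSEQ_power_zero) auto
    then have "\<forall>\<^sub>F k in sequentially. C * b ^ k * K < e"
      using that by (intro order_tendstoD(2)) auto
    from eventually_happens'[OF sequentially_bot this] show ?thesis .
  qed
  have "Cauchy V"
  proof (rule CauchyI)
    fix e :: real assume "0 < e"
    then obtain M where M: "C * b ^ M * (2 / (1 - b)) < e" using small[of e "2 / (1 - b)"] b by auto
    have "norm (V m - V n) < e" if "M \<le> m" "M \<le> n" for m n
    proof -
      have "norm (V m - V n) \<le> norm (V m - V M) + norm (V n - V M)"
        using norm_triangle_ineq4[of "V m - V M" "V n - V M"] by simp
      also have "\<dots> \<le> C * b ^ M / (1 - b) + C * b ^ M / (1 - b)"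
        using that b C step by (intro add_mono geometric_telescope) auto
      also have "\<dots> = C * b ^ M * (2 / (1 - b))" by simp
      finally show ?thesis using M by linarith
    qed
    then show "\<exists>M. \<forall>m\<ge>M. \<forall>n\<ge>M. norm (V m - V n) < e" by blast
  qed
  then obtain L where L: "V \<longlonglongrightarrow> L" using Cauchy_convergent convergent_def by blast
  have bound: "norm (L - V k) \<le> C * b ^ k / (1 - b)" for k
    using b C step L by (intro geometric_telescope_limit) auto
  have "(g \<longlongrightarrow> L) (at_right 0)"
  proof (rule tendstoI)
    fix e :: real assume "0 < e"
    then obtain k0 where k0: "C * b ^ k0 * (1 + 1 / (1 - b)) < e" using small[of e "1 + 1 / (1 - b)"] b by auto
    have "dist (g s) L < e" if s: "0 < s" "s < \<theta> ^ k0 * \<rho>" for s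
    proof -
      have tk: "0 < \<theta> ^ k0" using \<theta> by simp
      have "0 < s / (\<theta> ^ k0 * \<rho>)" "s / (\<theta> ^ k0 * \<rho>) < 1" using s tk \<rho> by auto
      then obtain j where j: "\<theta> ^ Suc j \<le> s / (\<theta> ^ k0 * \<rho>)" "s / (\<theta> ^ k0 * \<rho>) < \<theta> ^ j"
        using power_bracket[OF \<theta>] by blast
      have "\<theta> ^ Suc j * (\<theta> ^ k0 * \<rho>) \<le> s" "s < \<theta> ^ j * (\<theta> ^ k0 * \<rho>)"
        using j tk \<rho> by (simp_all only: pos_le_divide_eq pos_divide_less_eq mult_pos_pos)
      then have "norm (g s - V (k0 + j)) \<le> C * b ^ (k0 + j)"
        unfolding V_def by (intro H) (auto simp: power_add mult_ac)
      then have "dist (g s) L \<le> C * b ^ (k0 + j) * (1 + 1 / (1 - b))"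
        using bound[of "k0 + j"] norm_triangle_ineq4[of "g s - V (k0 + j)" "L - V (k0 + j)"]
        by (simp add: dist_norm algebra_simps)
      also have "\<dots> \<le> C * b ^ k0 * (1 + 1 / (1 - b))"
        using b C by (intro mult_right_mono mult_left_mono power_decreasing) auto
      finally show ?thesis using k0 by simp
    qed
    then show "\<forall>\<^sub>F s in at_right 0. dist (g s) L < e"
      using \<theta> \<rho> by (auto simp: eventually_at_right_field intro!: exI[of _ "\<theta> ^ k0 * \<rho>"])
  qed
  then show ?thesis using bound unfolding V_def by blast
qed

text \<open>\<tau> is a lower bound for the ratio of cube side to disk radius; its inverse square
  measures how far the kernel can exceed the uniform density on the disk.\<close>

definition osc_const :: "real \<Rightarrow> real \<Rightarrow> real" where
  "osc_const A \<tau> = 2 * (pi * (A + 2) / (kmass * \<tau>\<^sup>2))"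

text \<open>By Young's inequality \<open>t \<le> l + l powr (1 - p) * t powr p\<close>, the oscillation in \<open>L\<^sup>p\<close> controls the one in \<open>L\<^sup>1\<close>.\<close>

lemma kavg_diff_le_osc:
  fixes u :: "real ^ 2 \<Rightarrow> 'b::euclidean_space"
  assumes u: "integrable (lebesgue_on (ball x \<rho>)) u" and \<rho>: "0 < \<rho>" and p: "1 \<le> p"
    and osc: "osc p u (ball x \<rho>) \<le> ennreal (A * l powr p)" and A: "0 \<le> A" and l: "0 < l"
    and \<tau>: "0 < \<tau>" "\<rho> * \<tau> \<le> s" "\<rho> * \<tau> \<le> s'"
    and cubes: "cube y s \<subseteq> ball x \<rho>" "cube y' s' \<subseteq> ball x \<rho>"
  shows "norm (kavg u y s - kavg u y' s') \<le> osc_const A \<tau> * l"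
proof -
  let ?B = "ball x \<rho>"
  have \<rho>\<tau>: "0 < \<rho> * \<tau>" using \<rho> \<tau> by simp
  \<comment> \<open>Raising \<open>A\<close> to \<open>A + 1\<close> makes the inequality strict, so
    that an actual \<open>c\<close> can be extracted from the infimum. The term \<open>l\<close> of
    Young's inequality later raises it to \<open>A + 2\<close>.\<close>
  have "osc p u ?B < ennreal ((A + 1) * l powr p)"
    by (rule le_less_trans[OF osc]) (use A l in \<open>simp add: ennreal_less_iff\<close>)
  then obtain c where c: "(\<integral>\<^sup>+ y. ennreal (norm (u y - c) powr p) \<partial>lebesgue_on ?B) * ennreal (1 / (pi * \<rho>\<^sup>2)) < ennreal ((A + 1) * l powr p)"
    unfolding osc_disk[OF \<rho>] by (auto simp: INF_less_iff)
  let ?X = "\<integral>\<^sup>+ y. ennreal (norm (u y - c) powr p) \<partial>lebesgue_on ?B"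
  have X: "?X \<le> ennreal ((A + 1) * l powr p * (pi * \<rho>\<^sup>2))"
  proof -
    have one: "ennreal (1 / (pi * \<rho>\<^sup>2)) * ennreal (pi * \<rho>\<^sup>2) = 1"
      using \<rho> by (simp flip: ennreal_mult)
    have "?X = ?X * (ennreal (1 / (pi * \<rho>\<^sup>2)) * ennreal (pi * \<rho>\<^sup>2))" unfolding one by simp
    also have "\<dots> = ?X * ennreal (1 / (pi * \<rho>\<^sup>2)) * ennreal (pi * \<rho>\<^sup>2)" by (simp only: mult.assoc)
    also have "\<dots> \<le> ennreal ((A + 1) * l powr p) * ennreal (pi * \<rho>\<^sup>2)"
      using c by (intro mult_right_mono) auto
    also have "\<dots> = ennreal ((A + 1) * l powr p * (pi * \<rho>\<^sup>2))"
      using A by (intro ennreal_mult[symmetric]) auto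
    finally show ?thesis .
  qed
  have um: "(\<lambda>y. ennreal (norm (u y - c) powr p)) \<in> borel_measurable (lebesgue_on ?B)"
    using borel_measurable_integrable[OF u] by measurable
  have int: "integrable (lebesgue_on ?B) (\<lambda>y. norm (u y - c))"
    using u by (intro integrable_norm Bochner_Integration.integrable_diff) auto
  have young: "t \<le> l + l powr (1 - p) * t powr p" if "0 \<le> t" for t
  proof (cases "t \<le> l")
    case False
    then have "1 * t \<le> (t / l) powr (p - 1) * t"
      using l p that by (intro mult_right_mono ge_one_powr_ge_zero) auto
    also have "\<dots> = l powr (1 - p) * t powr p"
      using False l by (simp add: powr_divide powr_diff field_simps)
    finally show ?thesis using l by simp
  qed (use l in \<open>simp add: add_increasing2\<close>)
  have "ennreal (LINT y|lebesgue_on ?B. norm (u y - c)) = (\<integral>\<^sup>+ y. ennreal (norm (u y - c)) \<partial>lebesgue_on ?B)"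
    by (rule nn_integral_eq_integral[symmetric, OF int]) simp
  also have "\<dots> \<le> (\<integral>\<^sup>+ y. ennreal l + ennreal (l powr (1 - p)) * ennreal (norm (u y - c) powr p) \<partial>lebesgue_on ?B)"
    using l by (intro nn_integral_mono) (auto intro!: ennreal_leI young simp flip: ennreal_mult ennreal_plus)
  also have "\<dots> = ennreal l * emeasure lebesgue ?B + ennreal (l powr (1 - p)) * ?X"
    using um by (subst nn_integral_add)
      (auto simp: nn_integral_cmult emeasure_restrict_space simp del: emeasure_completion)
  also have "\<dots> \<le> ennreal l * ennreal (pi * \<rho>\<^sup>2) + ennreal (l powr (1 - p)) * ennreal ((A + 1) * l powr p * (pi * \<rho>\<^sup>2))"
    using X \<rho> by (intro add_mono mult_left_mono) (simp_all add: emeasure_disk del: emeasure_completion)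
  also have "\<dots> = ennreal (l * (pi * \<rho>\<^sup>2) + l powr (1 - p) * ((A + 1) * l powr p * (pi * \<rho>\<^sup>2)))"
    using A l by (simp flip: ennreal_mult ennreal_plus)
  also have "l * (pi * \<rho>\<^sup>2) + l powr (1 - p) * ((A + 1) * l powr p * (pi * \<rho>\<^sup>2)) = pi * \<rho>\<^sup>2 * (A + 2) * l"
    using l by (simp add: powr_diff algebra_simps)
  finally have I: "(LINT y|lebesgue_on ?B. norm (u y - c)) \<le> pi * \<rho>\<^sup>2 * (A + 2) * l"
    using A l by (subst (asm) ennreal_le_iff) auto
  have half: "norm (kavg u z t - c) \<le> pi * (A + 2) / (kmass * \<tau>\<^sup>2) * l" if "\<rho> * \<tau> \<le> t" "cube z t \<subseteq> ?B" for z t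
  proof -
    have t: "0 < t" using that \<rho>\<tau> by linarith
    have "norm (kavg u z t - c) \<le> 1 / (kmass * t\<^sup>2) * (LINT y|lebesgue_on ?B. norm (u y - c))"
      by (rule kavg_diff_const[OF t that(2) _ u]) simp
    also have "\<dots> \<le> 1 / (kmass * (\<rho> * \<tau>)\<^sup>2) * (pi * \<rho>\<^sup>2 * (A + 2) * l)"
    proof (rule mult_mono[OF _ I])
      show "1 / (kmass * t\<^sup>2) \<le> 1 / (kmass * (\<rho> * \<tau>)\<^sup>2)"
        using t \<rho> \<tau>(1) kmass_pos that(1)
        by (intro divide_left_mono mult_left_mono power_mono mult_pos_pos zero_less_power) auto
    qed (use kmass_pos in \<open>auto intro!: Bochner_Integration.integral_nonneg\<close>)
    also have "\<dots> = pi * (A + 2) / (kmass * \<tau>\<^sup>2) * l"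
      using \<rho> by (simp add: power_mult_distrib)
    finally show ?thesis .
  qed
  have "norm (kavg u y s - kavg u y' s') \<le> norm (kavg u y s - c) + norm (kavg u y' s' - c)"
    using norm_triangle_ineq4[of "kavg u y s - c" "kavg u y' s' - c"] by simp
  from order.trans[OF this add_mono[OF half[OF \<tau>(2) cubes(1)] half[OF \<tau>(3) cubes(2)]]]
  show ?thesis unfolding osc_const_def mult_2 distrib_right .
qed


text \<open>The summands in the first factor account for the limits at the two points, the passage
  between the points at their common scale, and pairs of distant points. The last factor, times the
  same power of the distance, bounds b^k from above.\<close>

definition holder_const :: "nat \<Rightarrow> real \<Rightarrow> real \<Rightarrow> real \<Rightarrow> real \<Rightarrow> real \<Rightarrow> real" where
  "holder_const N e A \<eta> \<theta> R =
    (2 * (osc_const A (\<theta> / 4) / (1 - \<theta> powr \<eta>)) + osc_const A (\<theta> / 4) + 2 * base_const N e (R / 4))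
    * (2 / (R * \<theta>)) powr \<eta>"

context disk_gradient
begin

lemma holder_estimate:
  assumes \<theta>: "0 < \<theta>" "\<theta> < 1" and \<eta>: "0 < \<eta>" and p: "1 \<le> p" and A: "0 \<le> A" and R: "0 < R"
    and K: "\<And>x. x \<in> K \<Longrightarrow> norm x + 4 * R \<le> 1"
    and decay: "\<And>x k. x \<in> K \<Longrightarrow> osc p u (ball x (\<theta> ^ k * R)) \<le> ennreal (A * (\<theta> powr (\<eta> * p)) ^ k)"
    and xy: "x \<in> K" "y \<in> K" "x \<noteq> y"
  defines "v \<equiv> \<lambda>x. Lim (at_right 0) (kavg u x)"
  shows "dist (v x) (v y) \<le> holder_const CARD('n) e A \<eta> \<theta> R * dist x y powr \<eta>"
proof -
  define b where "b = \<theta> powr \<eta>"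
  have b: "0 < b" "b < 1" using \<theta> \<eta> powr_less_mono2[of \<eta> \<theta> 1] by (auto simp: b_def)
  define C where "C = osc_const A (\<theta> / 4)"
  have C: "0 \<le> C" using A kmass_pos by (auto simp: C_def osc_const_def)
  have tk: "0 < \<theta> ^ k" "\<theta> ^ k \<le> 1" for k using \<theta> by (auto simp: power_le_one)
  have cmp: "norm (kavg u z s - kavg u z' s') \<le> C * b ^ k"
    if w: "w \<in> K" and s: "\<theta> ^ Suc k * (R / 4) \<le> s" "\<theta> ^ Suc k * (R / 4) \<le> s'"
      and cubes: "cube z s \<subseteq> ball w (\<theta> ^ k * R)" "cube z' s' \<subseteq> ball w (\<theta> ^ k * R)" for w k z z' s s'
    unfolding C_def
  proof (rule kavg_diff_le_osc[OF _ _ p _ A _ _ _ _ cubes])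
    have "\<theta> ^ k * R \<le> 1 * R" using tk[of k] R by (intro mult_right_mono) auto
    then have small: "norm w + \<theta> ^ k * R \<le> 1" using K[OF w] R by linarith
    have sub: "ball w (\<theta> ^ k * R) \<subseteq> unit_disk"
    proof
      fix q assume "q \<in> ball w (\<theta> ^ k * R)"
      then have "norm (q - w) < \<theta> ^ k * R" by (simp add: dist_norm norm_minus_commute)
      then have "norm q < 1" using small norm_triangle_sub[of q w] by linarith
      then show "q \<in> unit_disk" by simp
    qed
    show "integrable (lebesgue_on (ball w (\<theta> ^ k * R))) u"
      by (rule integrable_lebesgue_on_subset[OF integrable_u sub]) auto
    have "(b ^ k) powr p = (\<theta> powr (\<eta> * p)) ^ k"
      using \<theta> by (simp add: b_def powr_realpow[symmetric] powr_powr mult_ac)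
    then show "osc p u (ball w (\<theta> ^ k * R)) \<le> ennreal (A * (b ^ k) powr p)"
      using decay[OF w, of k] by simp
  qed (use tk R \<theta> b s in \<open>auto simp: mult_ac\<close>)
  \<comment> \<open>A cube whose side is at most a quarter of the radius reaches at most half the
    radius from its corner, leaving the other half for the distance between \<open>w\<close> and
    \<open>z\<close>.\<close>
  have cube_in: "cube z s \<subseteq> ball w (\<theta> ^ k * R)" if "s \<le> \<theta> ^ k * (R / 4)" "dist w z < \<theta> ^ k * R / 2" for w z s k
  proof
    fix q assume "q \<in> cube z s"
    from norm_cube_diff_le[OF this] have "dist z q \<le> \<theta> ^ k * R / 2"
      using that(1) by (simp add: dist_norm norm_minus_commute)
    then show "q \<in> ball w (\<theta> ^ k * R)" using that(2) dist_triangle[of w q z] by simp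
  qed
  define W where "W = (\<lambda>x k. kavg u x (\<theta> ^ k * (R / 4)))"
  have lim: "norm (v x - W x k) \<le> C * b ^ k / (1 - b)" if x: "x \<in> K" for x k
  proof -
    have "\<exists>L. (kavg u x \<longlongrightarrow> L) (at_right 0) \<and> (\<forall>k. norm (L - kavg u x (\<theta> ^ k * (R / 4))) \<le> C * b ^ k / (1 - b))"
    proof (rule scale_limit[OF \<theta> b _ C])
      fix k s assume s: "\<theta> ^ Suc k * (R / 4) \<le> s" "s \<le> \<theta> ^ k * (R / 4)"
      show "norm (kavg u x s - kavg u x (\<theta> ^ k * (R / 4))) \<le> C * b ^ k"
        using s tk[of k] R \<theta> by (intro cmp[OF x] cube_in) auto
    qed (use R in simp)
    then obtain L where L: "(kavg u x \<longlongrightarrow> L) (at_right 0)" "\<And>k. norm (L - kavg u x (\<theta> ^ k * (R / 4))) \<le> C * b ^ k / (1 - b)"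
      by blast
    have "v x = L" unfolding v_def using L(1) by (intro tendsto_Lim) auto
    then show ?thesis using L(2)[of k] by (simp add: W_def)
  qed
  define B where "B = base_const CARD('n) e (R / 4)"
  have B: "0 \<le> B" using kmass_pos R e_nonneg by (simp add: B_def base_const_def)
  have Cb: "0 \<le> C / (1 - b)" using C b by simp
  let ?d = "dist x y"
  have d: "0 < ?d" using xy by simp
  have Rt: "(2 / (R * \<theta>)) powr \<eta> * ?d powr \<eta> = (2 * ?d / (R * \<theta>)) powr \<eta>"
    by (simp add: powr_mult[symmetric])
  have tri: "dist (v x) (v y) \<le> norm (v x - a) + norm (v y - a') + norm (a - a')" for a a'
  proof -
    have "norm (P - Q + T) \<le> norm P + norm Q + norm T" for P Q T :: "real ^ 'n"
      using norm_triangle_ineq[of "P - Q" T] norm_triangle_ineq4[of P Q] by linarith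
    from this[of "v x - a" "v y - a'" "a - a'"] show ?thesis by (simp add: dist_norm)
  qed
  have "dist (v x) (v y) \<le> (2 * (C / (1 - b)) + C + 2 * B) * (2 * ?d / (R * \<theta>)) powr \<eta>"
  proof (cases "2 * ?d / R < 1")
    case True
    have "0 < 2 * ?d / R" using d R by simp
    \<comment> \<open>\<open>k\<close> is the finest scale at which the distance is still below half
      the radius \<theta>^k R, so that both cubes fit into the disk around \<open>x\<close>.\<close>
    from power_bracket[OF \<theta> this True] obtain k where k: "\<theta> ^ Suc k \<le> 2 * ?d / R" "2 * ?d / R < \<theta> ^ k" by blast
    have dk: "?d < \<theta> ^ k * R / 2" using k(2) R by (simp add: pos_divide_less_eq)
    have "norm (W x k - W y k) \<le> C * b ^ k"
      unfolding W_def
    proof (rule cmp[OF xy(1)])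
      show le: "\<theta> ^ Suc k * (R / 4) \<le> \<theta> ^ k * (R / 4)" "\<theta> ^ Suc k * (R / 4) \<le> \<theta> ^ k * (R / 4)"
        using R \<theta> by (intro mult_right_mono power_decreasing; simp)+
      show "cube x (\<theta> ^ k * (R / 4)) \<subseteq> ball x (\<theta> ^ k * R)" "cube y (\<theta> ^ k * (R / 4)) \<subseteq> ball x (\<theta> ^ k * R)"
        using dk tk[of k] R by (intro cube_in; simp)+
    qed
    then have "dist (v x) (v y) \<le> C * b ^ k / (1 - b) + C * b ^ k / (1 - b) + C * b ^ k"
      using tri[of "W x k" "W y k"] lim[OF xy(1), of k] lim[OF xy(2), of k] by linarith
    also have "\<dots> = (2 * (C / (1 - b)) + C) * b ^ k" by (simp add: distrib_right)
    also have "\<dots> \<le> (2 * (C / (1 - b)) + C + 2 * B) * (2 * ?d / (R * \<theta>)) powr \<eta>"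
    proof (rule mult_mono)
      have "b ^ k = (\<theta> ^ k) powr \<eta>"
        using \<theta> by (simp add: b_def powr_realpow[symmetric] powr_powr mult_ac)
      also have "\<dots> \<le> (2 * ?d / (R * \<theta>)) powr \<eta>"
      proof (rule powr_mono2)
        show "\<theta> ^ k \<le> 2 * ?d / (R * \<theta>)"
          using k(1) \<theta> R by (simp add: field_simps)
      qed (use \<eta> tk[of k] in auto)
      finally show "b ^ k \<le> (2 * ?d / (R * \<theta>)) powr \<eta>" .
    qed (use B Cb C b in auto)
    finally show ?thesis .
  next
    case False
    then have "1 \<le> 2 * ?d / R" by simp
    also have "\<dots> \<le> 2 * ?d / (R * \<theta>)"
      using \<theta> R d by (intro divide_left_mono) auto
    finally have ge: "1 \<le> (2 * ?d / (R * \<theta>)) powr \<eta>" using \<eta> by (intro ge_one_powr_ge_zero) auto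
    \<comment> \<open>At distance at least R/2 the oscillation on a common disk is no longer
      available; both averages at the coarsest scale are compared with the one at 0, at the price of
      the energy.\<close>
    have base: "norm (W z 0 - kavg u 0 (R / 4)) \<le> B" if "z \<in> K" for z
      unfolding W_def B_def using kavg_diff_origin[of "R / 4" z] K[OF that] R by simp
    have "norm (W x 0 - W y 0) \<le> 2 * B"
      using base[OF xy(1)] base[OF xy(2)] norm_triangle_ineq4[of "W x 0 - kavg u 0 (R / 4)" "W y 0 - kavg u 0 (R / 4)"] by simp
    then have "dist (v x) (v y) \<le> (2 * (C / (1 - b)) + 2 * B) * 1"
      using tri[of "W x 0" "W y 0"] lim[OF xy(1), of 0] lim[OF xy(2), of 0] by simp
    also have "\<dots> \<le> (2 * (C / (1 - b)) + C + 2 * B) * (2 * ?d / (R * \<theta>)) powr \<eta>"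
      using ge B Cb C by (intro mult_mono) auto
    finally show ?thesis .
  qed
  then show ?thesis unfolding holder_const_def Rt[symmetric] C_def[symmetric] b_def[symmetric] B_def[symmetric]
    by (simp only: mult.assoc)
qed

text \<open>The start of the iteration. The margin of 4 R keeps the disk within the region of radius
  1 - 3 R on which the \<open>L^p\<close> bound holds.\<close>

lemma osc_initial:
  assumes R: "0 < R" and x: "norm x + 4 * R \<le> 1" and p: "1 \<le> p"
  shows "osc p u (ball x R) \<le> ennreal (lp_const CARD('n) e p R / (pi * R\<^sup>2))"
proof -
  let ?c = "kavg u 0 R" and ?S = "ball 0 (1 - 3 * R) :: (real ^ 2) set"
  have sub: "ball x R \<subseteq> ?S"
  proof
    fix y assume "y \<in> ball x R"
    then show "y \<in> ?S" using x norm_triangle_sub[of y x] by (simp add: dist_norm norm_minus_commute)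
  qed
  have "(\<integral>\<^sup>+ y. ennreal (norm (u y - ?c) powr p) \<partial>lebesgue_on (ball x R))
      = (\<integral>\<^sup>+ y. ennreal (norm (u y - ?c) powr p) * indicator (ball x R) y \<partial>lebesgue)"
    by (subst nn_integral_restrict_space) auto
  also have "\<dots> \<le> (\<integral>\<^sup>+ y. ennreal (norm (u y - ?c) powr p) * indicator ?S y \<partial>lebesgue)"
    using sub by (intro nn_integral_mono mult_left_mono) (auto simp: indicator_def simp del: mem_ball)
  also have "\<dots> = (\<integral>\<^sup>+ y. ennreal (norm (u y - ?c) powr p) \<partial>lebesgue_on ?S)"
    by (subst nn_integral_restrict_space) auto
  also have "\<dots> \<le> ennreal (lp_const CARD('n) e p R)"
    by (rule nn_integral_norm_powr_le[OF R p])
  finally have I: "(\<integral>\<^sup>+ y. ennreal (norm (u y - ?c) powr p) \<partial>lebesgue_on (ball x R)) \<le> ennreal (lp_const CARD('n) e p R)" .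
  have "osc p u (ball x R)
      \<le> (\<integral>\<^sup>+ y. ennreal (norm (u y - ?c) powr p) \<partial>lebesgue_on (ball x R)) * ennreal (1 / (pi * R\<^sup>2))"
    unfolding osc_disk[OF R] by (rule INF_lower) simp
  also have "\<dots> \<le> ennreal (lp_const CARD('n) e p R) * ennreal (1 / (pi * R\<^sup>2))"
    by (intro mult_right_mono I) simp
  also have "\<dots> = ennreal (lp_const CARD('n) e p R / (pi * R\<^sup>2))"
    using R by (simp flip: ennreal_mult'')
  finally show ?thesis .
qed

end

section \<open>Assembling the estimate for the class of pairs\<close>

lemma disk_gradient_H1:
  assumes "u \<in> H1_on unit_disk"
  shows "disk_gradient u (weak_gradient unit_disk u) (2 * dirichlet_energy u unit_disk)"
proof
  have u: "u \<in> borel_measurable (lebesgue_on unit_disk)"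
      "integrable (lebesgue_on unit_disk) (\<lambda>x. norm (u x) powr 2)"
    using assms by (auto simp: H1_on_def Lp_on_def)
  show "is_weak_gradient_on unit_disk u (weak_gradient unit_disk u)"
    using assms someI_ex[of "is_weak_gradient_on unit_disk u"] by (auto simp: H1_on_def weak_gradient_def)
  show "integrable (lebesgue_on unit_disk) u"
  proof (rule Bochner_Integration.integrable_bound[OF _ u(1)])
    show "integrable (lebesgue_on unit_disk) (\<lambda>x. 1 + norm (u x) powr 2)"
      using u(2) by (intro Bochner_Integration.integrable_add) auto
    have "t \<le> 1 + t powr 2" if "0 \<le> t" for t :: real
    proof -
      have "0 \<le> (t - 1)\<^sup>2 + t\<^sup>2 + 1" by simp
      then show ?thesis using that by (simp add: power2_eq_square algebra_simps)
    qed
    then show "AE x in lebesgue_on unit_disk. norm (u x) \<le> norm (1 + norm (u x) powr 2)"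
      by (intro AE_I2) simp
  qed
  show "integrable (lebesgue_on unit_disk) (\<lambda>y. (norm (weak_gradient unit_disk u y))\<^sup>2)"
    using assms by (auto simp: H1_on_def Lp_on_def)
  show "(LINT y|lebesgue_on unit_disk. (norm (weak_gradient unit_disk u y))\<^sup>2) = 2 * dirichlet_energy u unit_disk"
    by (simp add: dirichlet_energy_def)
qed

text \<open>The boundary point on the ray through \<open>x\<close> is at distance
  \<open>1 - norm x\<close>; for \<open>x = 0\<close> a fixed unit vector takes its place.\<close>

lemma setdist_frontier_disk:
  assumes K: "compact K" "K \<subseteq> unit_disk" and x: "x \<in> K"
  shows "0 < setdist K (frontier unit_disk)" "norm x + setdist K (frontier unit_disk) \<le> 1"
proof -
  let ?d = "setdist K (frontier unit_disk)"
  have fr: "frontier unit_disk = sphere (0 :: real ^ 2) 1" by simp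
  define y :: "real ^ 2" where "y = (if x = 0 then axis 1 1 else (1 / norm x) *\<^sub>R x)"
  have y: "y \<in> frontier unit_disk" by (auto simp: fr y_def norm_axis_1)
  have "dist x y = 1 - norm x"
  proof (cases "x = 0")
    case False
    have "norm x < 1" using x K by auto
    have "x - y = (1 - 1 / norm x) *\<^sub>R x" using False by (simp add: y_def algebra_simps)
    then have "dist x y = \<bar>1 - 1 / norm x\<bar> * norm x" by (simp add: dist_norm)
    also have "\<bar>1 - 1 / norm x\<bar> = 1 / norm x - 1" using False \<open>norm x < 1\<close> by (simp add: abs_if field_simps)
    also have "(1 / norm x - 1) * norm x = 1 - norm x" using False by (simp add: left_diff_distrib)
    finally show ?thesis .
  qed (simp add: y_def norm_axis_1)
  then show "norm x + ?d \<le> 1" using setdist_le_dist[OF x y] by simp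
  have "K \<inter> frontier unit_disk = {}" using K by (auto simp: fr)
  then have "?d \<noteq> 0"
    using x y K setdist_eq_0_compact_closed[OF K(1), of "frontier unit_disk"] by auto
  then show "0 < ?d" using setdist_pos_le[of K "frontier unit_disk"] by linarith
qed

text \<open>Since \<open>ln \<theta>\<close> is negative, clearing the denominator reverses the
  inequality. The threshold is exactly the \<eta> at which both sides of the conclusion
  agree.\<close>

lemma powr_gt_of_exponent_less:
  fixes \<theta> \<gamma> p \<eta> :: real
  assumes "0 < \<theta>" "\<theta> < 1" "0 < \<gamma>" "1 \<le> p" "\<eta> < ln \<gamma> / (p * ln \<theta>)"
  shows "\<gamma> < \<theta> powr (\<eta> * p)"
proof -
  have "p * ln \<theta> < 0" using assms by (simp add: mult_pos_neg)
  then have "ln \<gamma> < \<eta> * (p * ln \<theta>)" using assms(5) by (simp add: neg_less_divide_eq)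
  then have "exp (ln \<gamma>) < exp (\<eta> * (p * ln \<theta>))" by simp
  then show ?thesis using assms by (simp add: powr_def mult.assoc)
qed

theorem theorem3p3:
  fixes q :: real
  assumes "q > 1"
  shows "\<exists>C :: real \<Rightarrow> real \<Rightarrow> real \<Rightarrow> real \<Rightarrow> real \<Rightarrow> real \<Rightarrow> real \<Rightarrow> real \<Rightarrow> real.
    \<forall>(S :: ((real ^ 2 \<Rightarrow> real ^ 'n) \<times> (real ^ 2 \<Rightarrow> real ^ 'n)) set) \<theta> \<gamma> \<kappa> p.
      S \<subseteq> H1_on unit_disk \<times> Lp_on q unit_disk \<and>
      rescaling_closed S \<and>
      0 < \<theta> \<and> \<theta> < 1 \<and> 0 < \<gamma> \<and> \<gamma> < 1 \<and> p \<ge> 1 \<and> \<kappa> > 0 \<and>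
      osc_decay q \<theta> \<gamma> \<kappa> p S \<longrightarrow>
      (\<forall>(u, f) \<in> S. \<exists>v. ae_eq_on unit_disk v u \<and>
        (\<forall>\<eta>. 0 < \<eta> \<and> \<eta> < 1 \<and> \<eta> < min (ln \<gamma> / (p * ln \<theta>)) (2 - 2 / q) \<longrightarrow>
          locally_holder_on \<eta> unit_disk v \<and>
          (\<forall>K. compact K \<and> K \<subseteq> unit_disk \<longrightarrow>
            holder_seminorm \<eta> K v \<le>
              ennreal (C \<eta> \<theta> \<gamma> \<kappa> p (dirichlet_energy u unit_disk)
                         (Lp_norm_on q unit_disk f) (setdist K (frontier unit_disk))))))"
proof -
  \<comment> \<open>The radius d/4 meets the requirement \<open>norm x + 4 * R \<le> 1\<close> of
    the Hoelder estimate at all points of \<open>K\<close>.\<close>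
  define A where "A = (\<lambda>\<eta> \<theta> \<gamma> \<kappa> p E F d. lp_const CARD('n) (2 * E) p (d / 4) / (pi * (d / 4)\<^sup>2)
    + \<kappa> * F powr p / (\<theta> powr (\<eta> * p) - \<gamma>))"
  define C where "C = (\<lambda>\<eta> \<theta> \<gamma> \<kappa> p E F d. holder_const CARD('n) (2 * E) (A \<eta> \<theta> \<gamma> \<kappa> p E F d) \<eta> \<theta> (d / 4))"
  have main: "\<exists>v. ae_eq_on unit_disk v u \<and>
      (\<forall>\<eta>. 0 < \<eta> \<and> \<eta> < 1 \<and> \<eta> < min (ln \<gamma> / (p * ln \<theta>)) (2 - 2 / q) \<longrightarrow>
        locally_holder_on \<eta> unit_disk v \<and>
        (\<forall>K. compact K \<and> K \<subseteq> unit_disk \<longrightarrow>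
          holder_seminorm \<eta> K v \<le>
            ennreal (C \<eta> \<theta> \<gamma> \<kappa> p (dirichlet_energy u unit_disk)
                       (Lp_norm_on q unit_disk f) (setdist K (frontier unit_disk)))))"
    if S: "S \<subseteq> H1_on unit_disk \<times> Lp_on q unit_disk" "rescaling_closed S" "osc_decay q \<theta> \<gamma> \<kappa> p S"
      and par: "0 < \<theta>" "\<theta> < 1" "0 < \<gamma>" "1 \<le> p" "0 < \<kappa>" and uf: "(u, f) \<in> S"
    for S :: "((real ^ 2 \<Rightarrow> real ^ 'n) \<times> (real ^ 2 \<Rightarrow> real ^ 'n)) set" and \<theta> \<gamma> \<kappa> p u f
  proof -
    let ?E = "dirichlet_energy u unit_disk" and ?F = "Lp_norm_on q unit_disk f"
    interpret disk_gradient u "weak_gradient unit_disk u" "2 * ?E"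
      using S(1) uf by (intro disk_gradient_H1) auto
    \<comment> \<open>Depends on \<open>u\<close> alone and precedes the choice of \<eta>, so one
      representative serves all exponents and all \<open>K\<close>.\<close>
    define v where "v = (\<lambda>x. Lim (at_right 0) (kavg u x))"
    have ae: "ae_eq_on unit_disk v u"
      unfolding ae_eq_on_def using AE_kavg_tendsto[OF open_ball integrable_u]
      by eventually_elim (auto simp: v_def intro!: tendsto_Lim)
    have bound: "holder_seminorm \<eta> K v \<le> ennreal (C \<eta> \<theta> \<gamma> \<kappa> p ?E ?F (setdist K (frontier unit_disk)))"
      if \<eta>: "0 < \<eta>" "\<eta> < ln \<gamma> / (p * ln \<theta>)" "\<eta> < 2 - 2 / q" and K: "compact K" "K \<subseteq> unit_disk" for \<eta> K
    proof -
      define d where "d = setdist K (frontier unit_disk)"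
      have "ennreal (dist (v x) (v y) / dist x y powr \<eta>) \<le> ennreal (C \<eta> \<theta> \<gamma> \<kappa> p ?E ?F d)"
        if xy: "x \<in> K" "y \<in> K" "x \<noteq> y" for x y
      proof (rule ennreal_leI)
        \<comment> \<open>These facts come from a point of \<open>K\<close>; for empty
          \<open>K\<close> the seminorm is a supremum over the empty set.\<close>
        have d: "0 < d" and Kd: "\<And>x. x \<in> K \<Longrightarrow> norm x + 4 * (d / 4) \<le> 1"
          using setdist_frontier_disk[OF K] xy by (auto simp: d_def)
        have d1: "d \<le> 1" using Kd[OF xy(1)] norm_ge_zero[of x] by linarith
        have gap: "\<gamma> < \<theta> powr (\<eta> * p)" using par \<eta> by (intro powr_gt_of_exponent_less) auto
        let ?A0 = "lp_const CARD('n) (2 * ?E) p (d / 4) / (pi * (d / 4)\<^sup>2)"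
        have A0: "0 \<le> ?A0"
          using e_nonneg by (auto simp: lp_const_def sobolev_const_def intro!: divide_nonneg_nonneg mult_nonneg_nonneg add_nonneg_nonneg)
        have A: "0 \<le> A \<eta> \<theta> \<gamma> \<kappa> p ?E ?F d"
          unfolding A_def using gap par by (intro add_nonneg_nonneg[OF A0] divide_nonneg_nonneg mult_nonneg_nonneg) auto
        have "dist (v x) (v y) \<le> C \<eta> \<theta> \<gamma> \<kappa> p ?E ?F d * dist x y powr \<eta>"
          unfolding C_def v_def
        proof (rule holder_estimate[OF par(1,2) \<eta>(1) par(4) A _ Kd _ xy])
          fix z k assume z: "z \<in> K"
          have sub: "ball z (d / 4) \<subseteq> unit_disk"
          proof
            fix w assume "w \<in> ball z (d / 4)"
            then have "norm (w - z) < d / 4" by (simp add: dist_norm norm_minus_commute)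
            then show "w \<in> unit_disk" using Kd[OF z] d norm_triangle_sub[of w z] by simp
          qed
          show "osc p u (ball z (\<theta> ^ k * (d / 4))) \<le> ennreal (A \<eta> \<theta> \<gamma> \<kappa> p ?E ?F d * (\<theta> powr (\<eta> * p)) ^ k)"
            unfolding A_def
          proof (rule osc_decay_iterated[OF S \<open>q > 1\<close> par(1,2,4,5,3) \<eta>(1) gap _ uf _ _ sub])
            show "osc p u (ball z (d / 4)) \<le> ennreal ?A0"
              using d Kd[OF z] par by (intro osc_initial) auto
          qed (use \<eta> d d1 A0 in auto)
        qed (use d in auto)
        then show "dist (v x) (v y) / dist x y powr \<eta> \<le> C \<eta> \<theta> \<gamma> \<kappa> p ?E ?F d"
          using xy by (simp add: divide_le_eq)
      qed
      then show ?thesis unfolding holder_seminorm_def d_def[symmetric] by (intro SUP_least) auto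
    qed
    show ?thesis
    proof (intro exI[of _ v] conjI ae allI impI)
      fix \<eta> assume "0 < \<eta> \<and> \<eta> < 1 \<and> \<eta> < min (ln \<gamma> / (p * ln \<theta>)) (2 - 2 / q)"
      then have \<eta>: "0 < \<eta>" "\<eta> < ln \<gamma> / (p * ln \<theta>)" "\<eta> < 2 - 2 / q" by auto
      show "locally_holder_on \<eta> unit_disk v"
        unfolding locally_holder_on_def
        using bound[OF \<eta>] le_less_trans[OF _ ennreal_less_top] by (auto simp: infinity_ennreal_def)
      fix K assume "compact K \<and> K \<subseteq> unit_disk"
      then show "holder_seminorm \<eta> K v \<le> ennreal (C \<eta> \<theta> \<gamma> \<kappa> p ?E ?F (setdist K (frontier unit_disk)))"
        using bound[OF \<eta>] by blast
    qed
  qed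
  show ?thesis
  proof (intro exI[of _ C] allI impI ballI, clarify)
    fix S :: "((real ^ 2 \<Rightarrow> real ^ 'n) \<times> (real ^ 2 \<Rightarrow> real ^ 'n)) set" and \<theta> \<gamma> \<kappa> p u f
    assume "S \<subseteq> H1_on unit_disk \<times> Lp_on q unit_disk" "rescaling_closed S" "0 < \<theta>" "\<theta> < 1" "0 < \<gamma>"
      "1 \<le> p" "0 < \<kappa>" "osc_decay q \<theta> \<gamma> \<kappa> p S" "(u, f) \<in> S"
    then show "\<exists>v. ae_eq_on unit_disk v u \<and>
      (\<forall>\<eta>. 0 < \<eta> \<and> \<eta> < 1 \<and> \<eta> < min (ln \<gamma> / (p * ln \<theta>)) (2 - 2 / q) \<longrightarrow>
        locally_holder_on \<eta> unit_disk v \<and>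
        (\<forall>K. compact K \<and> K \<subseteq> unit_disk \<longrightarrow>
          holder_seminorm \<eta> K v \<le>
            ennreal (C \<eta> \<theta> \<gamma> \<kappa> p (dirichlet_energy u unit_disk)
                       (Lp_norm_on q unit_disk f) (setdist K (frontier unit_disk)))))"
      by (intro main)
  qed
qed

end
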